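(* Let $\zeta,\theta>0$. For every compactly supported Lipschitz function $h:\mathbb{R}\to\mathbb{R}$ and every $\kappa>0$ there is a constant $C=C(h,\zeta,\theta,\kappa)>0$ such that for all real $T>1$ and all $a,b,c>0$ with $$a<b<1,\qquad c<\tfrac12,\qquad a\ge(\ln T)^{-\theta},\qquad \zeta\, b\le c^2,$$ one has, with $\Omega=\Omega_{[1,T)}^{(a,b],c}$, $$\int_{[0,1)^2}\theta_\kappa\big(S_\Omega h(\underline{x})-\mathcal{M}_\Omega(h)\big)\,d\underline{x}\le C\,c^{-2}\,b\,(\ln\ln T)^{3+\kappa}(\ln T)^2 .$$ In particular, for every $\kappa>0$ there is a constant $C'=C'(\zeta,\theta,\kappa)>0$ such that, for all such $T,a,b,c$, $$\int_{[0,1)^2}\theta_\kappa\big(|Q_\Omega(\underline{x})|-\mathrm{Vol}_3(\Omega)\big)\,d\underline{x}\le C'\,c^{-2}\,b\,(\ln\ln T)^{3+\kappa}(\ln T)^2 .$$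
   Context: For $z\in\mathbb{R}$, $\|z\|$ denotes the distance from $z$ to the closest integer; $\mathrm{Vol}_d$ is Lebesgue measure on $\mathbb{R}^d$; $\mathbb{N}=\{1,2,\dots\}$. For $\kappa>0$, $$\theta_\kappa(s):=\frac{s^2}{\ln(e+|s|)^{1+\kappa}},\qquad s\in\mathbb{R}$$ (not to be confused with the number $\theta$). Define $$\Omega_{[1,T)}^{(a,b],c}:=\{(\underline{u},y)\in\mathbb{R}^2\times[1,T):\ \max(|u_1|,|u_2|)\le c,\ a<|u_1u_2|\cdot y\le b\},$$ and for $\Omega=\Omega_{[1,T)}^{(a,b],c}$ and $\underline{x}=(x_1,x_2)\in\mathbb{R}^2$, $$Q_\Omega(\underline{x}):=\{q\in[1,T)\cap\mathbb{N}:\ \max(\|qx_1\|,\|qx_2\|)\le c,\ a<q\cdot\|qx_1\|\cdot\|qx_2\|\le b\},$$ $$S_\Omega h(\underline{x}):=\sum_{q\in Q_\Omega(\underline{x})}h(q/T),\qquad \mathcal{M}_\Omega(h):=\int_1^T h(y/T)\,\mathrm{Vol}_2(\Omega(y))\,dy,$$ where $\Omega(y):=\{\underline{u}\in\mathbb{R}^2:(\underline{u},y)\in\Omega\}$. (Since $a<1$, the hypothesis $a\ge(\ln T)^{-\theta}$ can only hold when $T>e$, so $\ln\ln T>0$.) *)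

theory Defs
  imports "HOL-Analysis.Analysis"
begin

text \<open>The Euclidean spaces of dimension 2 and 3 are rendered as \<^typ>\<open>real \<times> real\<close> and
  \<^typ>\<open>(real \<times> real) \<times> real\<close>, on which \<^const>\<open>lborel\<close> is Lebesgue measure.\<close>

definition dist_nearest_int :: "real \<Rightarrow> real" where
  "dist_nearest_int z = infdist z \<int>"

definition theta_fun :: "real \<Rightarrow> real \<Rightarrow> real" where
  "theta_fun \<kappa> s = s\<^sup>2 / ln (exp 1 + \<bar>s\<bar>) powr (1 + \<kappa>)"

definition compactly_supported :: "(real \<Rightarrow> real) \<Rightarrow> bool" where
  "compactly_supported h \<longleftrightarrow> compact (closure {x. h x \<noteq> 0})"

definition Omega :: "real \<Rightarrow> real \<Rightarrow> real \<Rightarrow> real \<Rightarrow> ((real \<times> real) \<times> real) set" where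
  "Omega T a b c = {((u1, u2), y). 1 \<le> y \<and> y < T \<and>
     max \<bar>u1\<bar> \<bar>u2\<bar> \<le> c \<and> a < \<bar>u1 * u2\<bar> * y \<and> \<bar>u1 * u2\<bar> * y \<le> b}"

definition slice :: "((real \<times> real) \<times> real) set \<Rightarrow> real \<Rightarrow> (real \<times> real) set" where
  "slice W y = {u. (u, y) \<in> W}"

definition Q_Omega :: "real \<Rightarrow> real \<Rightarrow> real \<Rightarrow> real \<Rightarrow> real \<times> real \<Rightarrow> nat set" where
  "Q_Omega T a b c = (\<lambda>(x1, x2). {q::nat. 1 \<le> real q \<and> real q < T \<and>
     max (dist_nearest_int (real q * x1)) (dist_nearest_int (real q * x2)) \<le> c \<and>
     a < real q * dist_nearest_int (real q * x1) * dist_nearest_int (real q * x2) \<and>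
     real q * dist_nearest_int (real q * x1) * dist_nearest_int (real q * x2) \<le> b})"

definition S_Omega ::
  "real \<Rightarrow> real \<Rightarrow> real \<Rightarrow> real \<Rightarrow> (real \<Rightarrow> real) \<Rightarrow> real \<times> real \<Rightarrow> real" where
  "S_Omega T a b c h x = (\<Sum>q\<in>Q_Omega T a b c x. h (real q / T))"

definition M_Omega :: "real \<Rightarrow> real \<Rightarrow> real \<Rightarrow> real \<Rightarrow> (real \<Rightarrow> real) \<Rightarrow> real" where
  "M_Omega T a b c h =
     (LINT y:{1..T}|lborel. h (y / T) * measure lborel (slice (Omega T a b c) y))"

end

theory Submission
  imports Defs "HOL-Number_Theory.Cong"
begin

text \<open>Since \<open>theta_fun \<kappa> s \<le> s\<^sup>2\<close>, an \<open>L\<^sup>2\<close> bound of order \<open>b (ln T)\<^sup>2\<close> suffices, as long as \<open>ln (ln T)\<close> is bounded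
  away from \<open>0\<close>; if it is not, then \<open>T / 4 < a\<close> and \<open>Omega\<close> is empty. The shell \<open>a < \<bar>u\<^sub>1 u\<^sub>2\<bar> y \<le> b\<close> is a difference
  of two star-shaped sets, which are treated separately.

  For \<open>q = g m\<close> and \<open>q' = g m'\<close> with \<open>m, m'\<close> coprime, the proportion of \<open>x\<close> with \<open>\<parallel>q x\<parallel> \<le> r\<close> and \<open>\<parallel>q' x\<parallel> \<le> r'\<close>
  differs from \<open>4 r r'\<close> by at most \<open>2 min (r / m) (r' / m')\<close>, which is the mass that the line spanned by
  \<open>(m, m')\<close> gives to the rectangle. The star-shaped sets have rectangular sections, so applying this in one
  coordinate at a time bounds the covariance of the events for \<open>q\<close> and \<open>q'\<close> by an integral over that line. With
  \<open>k\<^sub>m(t) = min 1 (b / (g m\<^sup>2 t))\<close>, the sum over \<open>m, m'\<close> of these integrands is controlled by \<open>(\<Sum>\<^sub>m k\<^sub>m(t))\<^sup>2\<close> and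
  \<open>\<Sum>\<^sub>m k\<^sub>m(t)\<close>, both of which are \<open>O(min N\<^sup>2 (b / (g t)))\<close>; integrating in \<open>t\<close> and summing over \<open>g\<close> each costs one
  logarithm.\<close>

section \<open>Distance to the nearest integer and periodic integrals\<close>

text \<open>The difference of \<open>S_Omega\<close> and \<open>M_Omega\<close> splits into a
  fluctuation and a bias. The fluctuation is centred exactly: for a single q the probability of the
  event equals the area of the star-shaped set, because multiplication by q preserves Lebesgue
  measure on the circle. Only genuine covariances remain to be estimated. The bias compares a sum
  over integers q with an integral over y; it is controlled because the areas decrease in y and h is
  Lipschitz.

  Shells are not compared directly, since their sections are not rectangles with a corner at the
  origin, the sets on which the joint law of two distances is estimated. The price is a variance and
  a bias at level a as well as at level b. This is where the lower bound on a enters: it gives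
  \<open>ln (1 / a) \<le> \<theta> * ln (ln T)\<close>, so logarithms at level a cost no more than a
  multiple of \<open>ln T\<close>.\<close>

lemma dist_nearest_int_eq: "dist_nearest_int z = \<bar>z - of_int (round z)\<bar>"
proof (rule antisym)
  show "dist_nearest_int z \<le> \<bar>z - of_int (round z)\<bar>"
    unfolding dist_nearest_int_def by (metis Ints_of_int dist_real_def infdist_le)
  have "\<bar>z - of_int (round z)\<bar> \<le> dist z a" if "a \<in> \<int>" for a
    using that round_diff_minimal[of z] by (auto simp: dist_real_def elim!: Ints_cases)
  then show "\<bar>z - of_int (round z)\<bar> \<le> dist_nearest_int z"
    unfolding dist_nearest_int_def infdist_def by (auto intro!: cINF_greatest)
qed

lemma dist_nearest_int_le_iff: "dist_nearest_int z \<le> r \<longleftrightarrow> (\<exists>n::int. \<bar>z - of_int n\<bar> \<le> r)"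
  unfolding dist_nearest_int_eq using round_diff_minimal[of z] order_trans by blast

lemma dist_nearest_int_nonneg [simp]: "0 \<le> dist_nearest_int z"
  by (simp add: dist_nearest_int_eq)

lemma dist_nearest_int_add_int [simp]: "dist_nearest_int (z + of_int n) = dist_nearest_int z"
proof -
  have le: "dist_nearest_int (w + of_int k) \<le> dist_nearest_int w" for w k
  proof -
    obtain j where "\<bar>w - of_int j\<bar> \<le> dist_nearest_int w"
      using dist_nearest_int_le_iff[of w "dist_nearest_int w"] by auto
    then have "\<bar>w + of_int k - of_int (j + k)\<bar> \<le> dist_nearest_int w" by simp
    then show ?thesis unfolding dist_nearest_int_le_iff by blast
  qed
  from le[of z n] le[of "z + of_int n" "- n"] show ?thesis by simp
qed

lemma dist_nearest_int_add_nat [simp]: "dist_nearest_int (z + real n) = dist_nearest_int z"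
  using dist_nearest_int_add_int[of z "int n"] by simp

lemma dist_nearest_int_abs:
  assumes "\<bar>u\<bar> \<le> 1/2"
  shows "dist_nearest_int u = \<bar>u\<bar>"
proof (rule antisym)
  show "dist_nearest_int u \<le> \<bar>u\<bar>"
    unfolding dist_nearest_int_le_iff by (rule exI[of _ 0]) simp
  obtain n :: int where n: "\<bar>u - of_int n\<bar> \<le> dist_nearest_int u"
    using dist_nearest_int_le_iff[of u "dist_nearest_int u"] by auto
  have "\<bar>u\<bar> \<le> \<bar>u - of_int n\<bar>"
  proof (cases "n = 0")
    case False
    then have "\<bar>real_of_int n\<bar> \<ge> 1" by linarith
    then show ?thesis using assms by linarith
  qed simp
  then show "\<bar>u\<bar> \<le> dist_nearest_int u" using n by simp
qed

lemma borel_measurable_dist_nearest_int [measurable]: "dist_nearest_int \<in> borel_measurable borel"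
  unfolding dist_nearest_int_def by (intro borel_measurable_continuous_onI continuous_intros)

text \<open>The shifted interval \<open>[s, 1 + s)\<close> wraps at most once: it is cut at 1 and
  the overhang is moved back by one period.\<close>

lemma nn_integral_periodic_shift:
  fixes \<Phi> :: "real \<Rightarrow> ennreal"
  assumes [measurable]: "\<Phi> \<in> borel_measurable borel"
    and per: "\<And>x. \<Phi> (x + 1) = \<Phi> x" and s: "0 \<le> s" "s \<le> 1"
  shows "(\<integral>\<^sup>+x. \<Phi> (x + s) * indicator {0..<1} x \<partial>lborel) = (\<integral>\<^sup>+x. \<Phi> x * indicator {0..<1} x \<partial>lborel)"
proof -
  have "(\<integral>\<^sup>+x. \<Phi> (x + s) * indicator {0..<1} x \<partial>lborel)
      = (\<integral>\<^sup>+x. \<Phi> x * indicator {0..<1} (x - s) \<partial>lborel)"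
    using nn_integral_real_affine[of "\<lambda>x. \<Phi> x * indicator {0..<1} (x - s)" 1 s]
    by (simp add: add.commute)
  also have "\<dots> = (\<integral>\<^sup>+x. \<Phi> x * indicator {s..<1} x + \<Phi> x * indicator {1..<1+s} x \<partial>lborel)"
    using s by (intro nn_integral_cong) (auto simp: indicator_def)
  also have "\<dots> = (\<integral>\<^sup>+x. \<Phi> x * indicator {s..<1} x \<partial>lborel) + (\<integral>\<^sup>+x. \<Phi> x * indicator {1..<1+s} x \<partial>lborel)"
    by (rule nn_integral_add) measurable
  also have "(\<integral>\<^sup>+x. \<Phi> x * indicator {1..<1+s} x \<partial>lborel) = (\<integral>\<^sup>+x. \<Phi> x * indicator {0..<s} x \<partial>lborel)"
    using nn_integral_real_affine[of "\<lambda>x. \<Phi> x * indicator {1..<1+s} x" 1 1] per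
    by (simp add: add.commute indicator_def)
  also have "(\<integral>\<^sup>+x. \<Phi> x * indicator {s..<1} x \<partial>lborel) + (\<integral>\<^sup>+x. \<Phi> x * indicator {0..<s} x \<partial>lborel)
     = (\<integral>\<^sup>+x. \<Phi> x * indicator {s..<1} x + \<Phi> x * indicator {0..<s} x \<partial>lborel)"
    by (rule nn_integral_add[symmetric]) measurable
  also have "\<dots> = (\<integral>\<^sup>+x. \<Phi> x * indicator {0..<1} x \<partial>lborel)"
    using s by (intro nn_integral_cong) (auto simp: indicator_def)
  finally show ?thesis .
qed

lemma periodic_add_nat:
  assumes "\<And>x::real. \<Phi> (x + 1) = \<Phi> x"
  shows "\<Phi> (x + real n) = \<Phi> x"
proof (induction n)
  case (Suc n)
  have "\<Phi> (x + real (Suc n)) = \<Phi> ((x + real n) + 1)" by (simp add: algebra_simps)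
  then show ?case using Suc assms by metis
qed simp

text \<open>The interval \<open>[0, q)\<close> consists of q periods, and the substitution by q x
  has Jacobian q; the two factors cancel.\<close>

lemma nn_integral_periodic_scale:
  fixes \<Phi> :: "real \<Rightarrow> ennreal"
  assumes [measurable]: "\<Phi> \<in> borel_measurable borel"
    and per: "\<And>x. \<Phi> (x + 1) = \<Phi> x" and q: "q > 0"
  shows "(\<integral>\<^sup>+x. \<Phi> (real q * x) * indicator {0..<1} x \<partial>lborel) = (\<integral>\<^sup>+x. \<Phi> x * indicator {0..<1} x \<partial>lborel)"
    (is "?L = ?R")
proof -
  have sum: "(\<integral>\<^sup>+x. \<Phi> x * indicator {0..<real n} x \<partial>lborel) = of_nat n * ?R" for n
  proof (induction n)
    case (Suc n)
    have "(\<integral>\<^sup>+x. \<Phi> x * indicator {0..<real (Suc n)} x \<partial>lborel)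
      = (\<integral>\<^sup>+x. \<Phi> x * indicator {0..<real n} x + \<Phi> x * indicator {real n..<real n + 1} x \<partial>lborel)"
      by (intro nn_integral_cong) (auto simp: indicator_def)
    also have "\<dots> = (\<integral>\<^sup>+x. \<Phi> x * indicator {0..<real n} x \<partial>lborel)
        + (\<integral>\<^sup>+x. \<Phi> x * indicator {real n..<real n + 1} x \<partial>lborel)"
      by (rule nn_integral_add) measurable
    also have "(\<integral>\<^sup>+x. \<Phi> x * indicator {real n..<real n + 1} x \<partial>lborel) = ?R"
      using nn_integral_real_affine[of "\<lambda>x. \<Phi> x * indicator {real n..<real n + 1} x" 1 "real n"]
        periodic_add_nat[of \<Phi>, OF per]
      by (simp add: add.commute indicator_def)
    finally show ?case using Suc by (simp add: algebra_simps)
  qed simp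
  have "of_nat q * ?R = (\<integral>\<^sup>+x. \<Phi> x * indicator {0..<real q} x \<partial>lborel)" by (simp add: sum)
  also have "\<dots> = of_nat q * ?L"
    using nn_integral_real_affine[of "\<lambda>x. \<Phi> x * indicator {0..<real q} x" "real q" 0] q
    by (simp add: indicator_def zero_le_mult_iff ennreal_of_nat_eq_real_of_nat)
  finally show ?thesis using q by (simp add: ennreal_mult_cancel_left)
qed

text \<open>Scaling by q and shifting by 1/2 move the unit interval to the period centred at 0,
  where the distance is the absolute value. The result no longer contains q, which is what makes the
  probability of each event an exact area.\<close>

lemma nn_integral_dist_nearest_int:
  fixes \<Psi> :: "real \<Rightarrow> ennreal"
  assumes [measurable]: "\<Psi> \<in> borel_measurable borel" and q: "q > 0"
  shows "(\<integral>\<^sup>+x. \<Psi> (dist_nearest_int (real q * x)) * indicator {0..<1} x \<partial>lborel)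
       = (\<integral>\<^sup>+u. \<Psi> \<bar>u\<bar> * indicator {-1/2..1/2} u \<partial>lborel)"
proof -
  have per: "dist_nearest_int (x + 1) = dist_nearest_int x" for x
    using dist_nearest_int_add_nat[of x 1] by simp
  let ?g = "\<lambda>x. \<Psi> (dist_nearest_int (x - 1/2))"
  have per2: "dist_nearest_int (x + 1 - 1/2) = dist_nearest_int (x - 1/2)" for x
    using per[of "x - 1/2"] by (simp add: algebra_simps)
  have "(\<integral>\<^sup>+x. \<Psi> (dist_nearest_int (real q * x)) * indicator {0..<1} x \<partial>lborel)
      = (\<integral>\<^sup>+x. \<Psi> (dist_nearest_int x) * indicator {0..<1} x \<partial>lborel)"
    using nn_integral_periodic_scale[of "\<lambda>x. \<Psi> (dist_nearest_int x)" q] per q by simp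
  also have "\<dots> = (\<integral>\<^sup>+x. ?g x * indicator {0..<1} x \<partial>lborel)"
    using nn_integral_periodic_shift[of ?g "1/2"] per2 by simp
  also have "\<dots> = (\<integral>\<^sup>+u. \<Psi> (dist_nearest_int u) * indicator {-1/2..<1/2} u \<partial>lborel)"
    using nn_integral_real_affine[of "\<lambda>u. ?g u * indicator {0..<1} u" 1 "1/2"]
    by (simp add: indicator_def) (intro nn_integral_cong arg_cong2[where f = times] refl, auto)
  \<comment> \<open>Closing the interval at 1/2 only adds a null set.\<close>
  also have "\<dots> = (\<integral>\<^sup>+u. \<Psi> \<bar>u\<bar> * indicator {-1/2..1/2} u \<partial>lborel)"
    by (intro nn_integral_cong_AE eventually_mono[OF AE_lborel_singleton[of "1/2"]])
      (auto simp: indicator_def dist_nearest_int_abs)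
  finally show ?thesis .
qed

section \<open>Counting rotations close to an integer, and the joint law of two distances\<close>

lemma card_int_interval:
  fixes A B :: real
  assumes "A \<le> B"
  shows "\<bar>real (card {z::int. A \<le> of_int z \<and> of_int z \<le> B}) - (B - A)\<bar> \<le> 1"
proof -
  have "{z::int. A \<le> of_int z \<and> of_int z \<le> B} = {\<lceil>A\<rceil>..\<lfloor>B\<rfloor>}"
    by (auto simp: ceiling_le_iff le_floor_iff)
  then show ?thesis using assms by simp linarith
qed

text \<open>After multiplication by m, nearness to an integer n says that the integer
  \<open>m' j - m n\<close> lies in an interval of length \<open>2 m r\<close>. Since m' is
  invertible modulo m, distinct \<open>j < m\<close> give distinct integers, and every integer of
  the interval arises.\<close>

lemma card_near_int_shifts:
  fixes m m' :: nat
  assumes "m > 0" "coprime m m'" "0 \<le> r" "r < 1/2"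
  shows "\<bar>real (card {j\<in>{..<m}. dist_nearest_int (y + real m' * real j / real m) \<le> r}) - 2 * real m * r\<bar> \<le> 1"
proof -
  let ?J = "{j\<in>{..<m}. dist_nearest_int (y + real m' * real j / real m) \<le> r}"
  let ?Z = "{z::int. - real m * y - real m * r \<le> of_int z \<and> of_int z \<le> - real m * y + real m * r}"
  let ?f = "\<lambda>j. int m' * int j - int m * round (y + real m' * real j / real m)"
  have scale: "real m * \<bar>w\<bar> = \<bar>real m * w\<bar>" for w by (simp add: abs_mult)
  have bij: "bij_betw ?f ?J ?Z"
  proof (rule bij_betwI')
    fix j k assume j: "j \<in> ?J" and k: "k \<in> ?J"
    show "?f j = ?f k \<longleftrightarrow> j = k"
    proof
      assume eq: "?f j = ?f k"
      have "int m' * int j - int m' * int k =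
          int m * (round (y + real m' * real j / real m) - round (y + real m' * real k / real m))"
        using eq by (simp add: algebra_simps)
      then have "[int m' * int j = int m' * int k] (mod int m)"
        unfolding cong_iff_dvd_diff by simp
      then have "[int j = int k] (mod int m)"
        using assms(2) cong_mult_lcancel[of "int m'" "int m"]
        by (simp add: coprime_commute)
      then show "j = k" using j k
        by (simp add: cong_int_iff cong_less_modulus_unique_nat)
    qed simp
  next
    fix j assume "j \<in> ?J"
    then have "\<bar>y + real m' * real j / real m - of_int (round (y + real m' * real j / real m))\<bar> \<le> r"
      by (simp add: dist_nearest_int_eq)
    then have "real m * \<bar>y + real m' * real j / real m - of_int (round (y + real m' * real j / real m))\<bar> \<le> real m * r"
      by (intro mult_left_mono) auto
    moreover have "real m * \<bar>y + real m' * real j / real m - of_int n\<bar>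
        = \<bar>real m * y + of_int (int m' * int j - int m * n)\<bar>" for n
      using scale[of "y + real m' * real j / real m - of_int n"] assms(1) by (simp add: algebra_simps)
    ultimately have "\<bar>real m * y + of_int (?f j)\<bar> \<le> real m * r" by simp
    then show "?f j \<in> ?Z" by (simp add: abs_le_iff algebra_simps)
  next
    fix z assume "z \<in> ?Z"
    then have z: "\<bar>real m * y + of_int z\<bar> \<le> real m * r" by (simp add: abs_le_iff algebra_simps)
    \<comment> \<open>The inverse of m' modulo m recovers the residue j from z.\<close>
    obtain w where w: "[int m' * w = 1] (mod int m)"
      using cong_solve_coprime_int[of "int m'" "int m"] assms(2) by (auto simp: coprime_commute)
    define j where "j = nat ((w * z) mod int m)"
    have ji: "int j = (w * z) mod int m" using assms(1) by (simp add: j_def)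
    have "[int m' * int j = int m' * (w * z)] (mod int m)"
      unfolding ji by (intro cong_mult) (auto simp: cong_def)
    also have "[int m' * (w * z) = z] (mod int m)"
      using cong_mult[OF w cong_refl[of z]] by (simp add: mult.assoc)
    finally obtain n where n: "int m' * int j - z = int m * n"
      unfolding cong_iff_dvd_diff dvd_def by auto
    then have "real_of_int (int m' * int j - z) = real_of_int (int m * n)" by (rule arg_cong)
    then have nr: "real m' * real j = of_int z + real m * of_int n" by simp
    have "real m * \<bar>y + real m' * real j / real m - of_int n\<bar> = \<bar>real m * y + of_int z\<bar>"
      using scale[of "y + real m' * real j / real m - of_int n"] assms(1) nr
      by (simp add: algebra_simps)
    then have "\<bar>y + real m' * real j / real m - of_int n\<bar> \<le> r"
      using z assms(1) by (metis mult_le_cancel_left_pos of_nat_0_less_iff)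
    \<comment> \<open>Here \<open>r < 1/2\<close> makes n the nearest integer, so \<open>?f\<close>
      sends j to z itself and not just to an integer congruent to z.\<close>
    moreover from this have "round (y + real m' * real j / real m) = n"
      using assms(4) by (intro round_unique') (simp add: abs_minus_commute)
    moreover have "j < m" using assms(1) ji by (metis pos_mod_bound of_nat_0_less_iff of_nat_less_iff)
    ultimately show "\<exists>j\<in>?J. z = ?f j"
      using n by (intro bexI[of _ j]) (auto simp: dist_nearest_int_le_iff)
  qed
  have "card ?J = card ?Z" using bij by (rule bij_betw_same_card)
  then show ?thesis
    using card_int_interval[of "- real m * y - real m * r" "- real m * y + real m * r"] assms
    by (simp add: mult.assoc mult.commute[of r])
qed

lemma emeasure_dist_nearest_int_le:
  assumes "q > 0" "0 \<le> r" "r < 1/2"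
  shows "(\<integral>\<^sup>+x. indicator {x. dist_nearest_int x \<le> r} (real q * x) * indicator {0..<1} x \<partial>lborel) = ennreal (2 * r)"
proof -
  have "(\<integral>\<^sup>+x. indicator {x. dist_nearest_int x \<le> r} (real q * x) * indicator {0..<1} x \<partial>lborel)
     = (\<integral>\<^sup>+u. indicator {..r} \<bar>u\<bar> * indicator {-1/2..1/2} u \<partial>lborel)"
    using nn_integral_dist_nearest_int[of "indicator {..r}" q] assms by (simp add: indicator_def)
  also have "\<dots> = (\<integral>\<^sup>+u. indicator {-r..r} u \<partial>lborel)"
    using assms by (intro nn_integral_cong) (auto simp: indicator_def)
  also have "\<dots> = ennreal (2 * r)" using assms by simp
  finally show ?thesis .
qed

text \<open>Averaging over the shifts \<open>x + j / (g m)\<close> for \<open>j < m\<close> leaves the first condition unchanged, while the number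
  of shifts satisfying the second one is within \<open>1\<close> of \<open>2 m r'\<close>.\<close>

lemma overlap_bounds:
  fixes g m m' :: nat and r r' :: real
  assumes pos: "g > 0" "m > 0" "m' > 0" and cop: "coprime m m'"
    and r: "0 \<le> r" "r < 1/2" and r': "0 \<le> r'" "r' < 1/2"
  defines "P \<equiv> emeasure lborel {x\<in>{0..<1}. dist_nearest_int (real (g * m) * x) \<le> r
                                \<and> dist_nearest_int (real (g * m') * x) \<le> r'}"
  shows "P \<le> ennreal (4 * r * r' + 2 * r / m)" and "ennreal (4 * r * r') \<le> P + ennreal (2 * r / m)"
proof -
  define F :: "real \<Rightarrow> ennreal" where "F = indicator {x. dist_nearest_int x \<le> r}"
  define F' :: "real \<Rightarrow> ennreal" where "F' = indicator {x. dist_nearest_int x \<le> r'}"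
  have [measurable]: "F \<in> borel_measurable borel" "F' \<in> borel_measurable borel"
    unfolding F_def F'_def by measurable
  have F_per: "F (x + real n) = F x" for x n by (simp add: F_def indicator_def)
  have F'_per: "F' (x + real n) = F' x" for x n by (simp add: F'_def indicator_def)
  define \<Phi> where "\<Phi> x = F (real (g * m) * x) * F' (real (g * m') * x)" for x
  have [measurable]: "\<Phi> \<in> borel_measurable borel" unfolding \<Phi>_def by measurable
  have \<Phi>_per: "\<Phi> (x + 1) = \<Phi> x" for x
    using F_per[of "real (g * m) * x" "g * m"] F'_per[of "real (g * m') * x" "g * m'"]
    by (simp add: \<Phi>_def algebra_simps)
  have P: "P = (\<integral>\<^sup>+x. \<Phi> x * indicator {0..<1} x \<partial>lborel)"
  proof -
    have "P = (\<integral>\<^sup>+x. indicator {x\<in>{0..<1}. dist_nearest_int (real (g * m) * x) \<le> r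
                                \<and> dist_nearest_int (real (g * m') * x) \<le> r'} x \<partial>lborel)"
      unfolding P_def by (rule nn_integral_indicator[symmetric]) measurable
    also have "\<dots> = (\<integral>\<^sup>+x. \<Phi> x * indicator {0..<1} x \<partial>lborel)"
      by (intro nn_integral_cong) (auto simp: \<Phi>_def F_def F'_def indicator_def)
    finally show ?thesis .
  qed
  \<comment> \<open>The shift by \<open>j / (g m)\<close> moves \<open>g m x\<close> by the integer
    j, which \<open>F\<close> does not see, and moves \<open>g m' x\<close> by
    \<open>m' j / m\<close>.\<close>
  have shift: "P = (\<integral>\<^sup>+x. F (real (g * m) * x) * F' (real (g * m') * x + real m' * real j / real m) * indicator {0..<1} x \<partial>lborel)"
    if "j < m" for j
  proof -
    have "real j / real (g * m) \<le> 1" using that pos by (simp add: field_simps mult_le_cancel_right1 order_trans[of "real j" "real m"])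
    then have "P = (\<integral>\<^sup>+x. \<Phi> (x + real j / real (g * m)) * indicator {0..<1} x \<partial>lborel)"
      unfolding P by (intro nn_integral_periodic_shift[symmetric]) (auto simp: \<Phi>_per)
    also have "\<dots> = (\<integral>\<^sup>+x. F (real (g * m) * x) * F' (real (g * m') * x + real m' * real j / real m) * indicator {0..<1} x \<partial>lborel)"
    proof (intro nn_integral_cong arg_cong2[where f = times] refl)
      fix x
      have 1: "real (g * m) * (x + real j / real (g * m)) = real (g * m) * x + real j"
        and 2: "real (g * m') * (x + real j / real (g * m)) = real (g * m') * x + real m' * real j / real m"
        using pos by (simp_all add: field_simps)
      show "\<Phi> (x + real j / real (g * m)) = F (real (g * m) * x) * F' (real (g * m') * x + real m' * real j / real m)"
        unfolding \<Phi>_def 1 2 F_per ..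
    qed
    finally show ?thesis .
  qed
  define J where "J x = {j\<in>{..<m}. dist_nearest_int (real (g * m') * x + real m' * real j / real m) \<le> r'}" for x
  have J: "of_nat (card (J x)) = (\<Sum>j<m. F' (real (g * m') * x + real m' * real j / real m))" for x
  proof -
    have "of_nat (card (J x)) = (\<Sum>j\<in>J x. 1 :: ennreal)" by simp
    also have "\<dots> = (\<Sum>j<m. F' (real (g * m') * x + real m' * real j / real m))"
      unfolding J_def by (subst sum.inter_filter) (auto simp: F'_def indicator_def of_bool_def)
    finally show ?thesis .
  qed
  have Jb: "\<bar>real (card (J x)) - 2 * real m * r'\<bar> \<le> 1" for x
    unfolding J_def using card_near_int_shifts pos cop r' by blast
  have Fint: "(\<integral>\<^sup>+x. F (real (g * m) * x) * indicator {0..<1} x \<partial>lborel) = ennreal (2 * r)"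
    unfolding F_def using emeasure_dist_nearest_int_le[of "g * m" r] pos r by simp
  have mP: "of_nat m * P = (\<integral>\<^sup>+x. of_nat (card (J x)) * (F (real (g * m) * x) * indicator {0..<1} x) \<partial>lborel)"
  proof -
    have "of_nat m * P = (\<Sum>j<m. P)" by simp
    also have "\<dots> = (\<Sum>j<m. \<integral>\<^sup>+x. F (real (g * m) * x) * F' (real (g * m') * x + real m' * real j / real m) * indicator {0..<1} x \<partial>lborel)"
      by (intro sum.cong) (auto dest: shift)
    also have "\<dots> = (\<integral>\<^sup>+x. (\<Sum>j<m. F (real (g * m) * x) * F' (real (g * m') * x + real m' * real j / real m) * indicator {0..<1} x) \<partial>lborel)"
      by (rule nn_integral_sum[symmetric]) measurable
    also have "\<dots> = (\<integral>\<^sup>+x. of_nat (card (J x)) * (F (real (g * m) * x) * indicator {0..<1} x) \<partial>lborel)"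
      unfolding J by (simp add: sum_distrib_left sum_distrib_right ac_simps)
    finally show ?thesis .
  qed
  have cm: "(\<integral>\<^sup>+x. c * (F (real (g * m) * x) * indicator {0..<1} x) \<partial>lborel) = c * ennreal (2 * r)" for c
    by (subst nn_integral_cmult) (measurable, simp only: Fint)
  have mEq: "of_nat m * ennreal y = ennreal (real m * y)" for y
    by (simp add: ennreal_mult' ennreal_of_nat_eq_real_of_nat)
  have "of_nat m * P \<le> (\<integral>\<^sup>+x. ennreal (2 * real m * r' + 1) * (F (real (g * m) * x) * indicator {0..<1} x) \<partial>lborel)"
    unfolding mP
  proof (intro nn_integral_mono mult_right_mono)
    show "of_nat (card (J x)) \<le> ennreal (2 * real m * r' + 1)" for x
      using Jb[of x] unfolding ennreal_of_nat_eq_real_of_nat by (intro ennreal_leI) linarith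
  qed simp
  also have "\<dots> = ennreal ((2 * real m * r' + 1) * (2 * r))"
    unfolding cm using r r' by (intro ennreal_mult[symmetric]) auto
  also have "\<dots> = of_nat m * ennreal (4 * r * r' + 2 * r / m)"
    using pos unfolding mEq by (intro arg_cong[where f = ennreal]) (simp add: field_simps)
  finally show "P \<le> ennreal (4 * r * r' + 2 * r / m)"
    using pos by (simp add: ennreal_mult_le_mult_iff)
  have "of_nat m * ennreal (4 * r * r') = ennreal (2 * real m * r') * ennreal (2 * r)"
    using r r' unfolding mEq by (simp flip: ennreal_mult add: ac_simps)
  also have "\<dots> = (\<integral>\<^sup>+x. ennreal (2 * real m * r') * (F (real (g * m) * x) * indicator {0..<1} x) \<partial>lborel)"
    unfolding cm ..
  \<comment> \<open>The counting error 1 is added on the right, so that no subtraction in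
    \<open>ennreal\<close> occurs; integrated against the first condition it contributes
    \<open>2 r\<close>.\<close>
  also have "\<dots> \<le> (\<integral>\<^sup>+x. (of_nat (card (J x)) + 1) * (F (real (g * m) * x) * indicator {0..<1} x) \<partial>lborel)"
  proof (intro nn_integral_mono mult_right_mono)
    fix x
    have "ennreal (2 * real m * r') \<le> ennreal (real (card (J x)) + 1)"
      using Jb[of x] by (intro ennreal_leI) linarith
    then show "ennreal (2 * real m * r') \<le> of_nat (card (J x)) + 1"
      by (simp add: ennreal_of_nat_eq_real_of_nat)
  qed simp
  also have "\<dots> = (\<integral>\<^sup>+x. of_nat (card (J x)) * (F (real (g * m) * x) * indicator {0..<1} x)
      + F (real (g * m) * x) * indicator {0..<1} x \<partial>lborel)"
    by (simp only: distrib_right mult_1)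
  also have "\<dots> = (\<integral>\<^sup>+x. of_nat (card (J x)) * (F (real (g * m) * x) * indicator {0..<1} x) \<partial>lborel)
      + (\<integral>\<^sup>+x. F (real (g * m) * x) * indicator {0..<1} x \<partial>lborel)"
    unfolding J by (rule nn_integral_add) measurable
  also have "\<dots> = of_nat m * P + ennreal (2 * r)"
    unfolding mP Fint ..
  also have "\<dots> = of_nat m * (P + ennreal (2 * r / m))"
    using pos by (simp add: distrib_left mEq)
  finally show "ennreal (4 * r * r') \<le> P + ennreal (2 * r / m)"
    using pos by (simp add: ennreal_mult_le_mult_iff)
qed

text \<open>Either condition can be the one that averaging leaves unchanged, so the smaller error is
  available. It is the length of the set of t with \<open>m * |t| \<le> r\<close> and
  \<open>m' * |t| \<le> r'\<close>, which lets the error be read as a measure of the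
  rectangle.\<close>

lemma overlap_bounds_min:
  fixes g m m' :: nat and r r' :: real
  assumes pos: "g > 0" "m > 0" "m' > 0" and cop: "coprime m m'"
    and r: "0 \<le> r" "r < 1/2" and r': "0 \<le> r'" "r' < 1/2"
  defines "P \<equiv> emeasure lborel {x\<in>{0..<1}. dist_nearest_int (real (g * m) * x) \<le> r
                                \<and> dist_nearest_int (real (g * m') * x) \<le> r'}"
  shows "P \<le> ennreal (4 * r * r') + ennreal (2 * min (r / m) (r' / m'))"
    and "ennreal (4 * r * r') \<le> P + ennreal (2 * min (r / m) (r' / m'))"
proof -
  have P': "P = emeasure lborel {x\<in>{0..<1}. dist_nearest_int (real (g * m') * x) \<le> r'
                                \<and> dist_nearest_int (real (g * m) * x) \<le> r}"
    unfolding P_def by (intro arg_cong[where f = "emeasure lborel"]) auto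
  note 1 = overlap_bounds[OF pos cop r r', folded P_def]
  note 2 = overlap_bounds[OF pos(1,3,2) _ r' r, folded P', unfolded coprime_commute[of m' m], OF cop]
  show "P \<le> ennreal (4 * r * r') + ennreal (2 * min (r / m) (r' / m'))"
    using 1(1) 2(1) r r' by (cases "r / m \<le> r' / m'") (auto simp: min_def ac_simps simp flip: ennreal_plus)
  show "ennreal (4 * r * r') \<le> P + ennreal (2 * min (r / m) (r' / m'))"
    using 1(2) 2(2) by (cases "r / m \<le> r' / m'") (auto simp: min_def ac_simps)
qed

section \<open>Comparing pair correlations with independence\<close>

text \<open>The roles of the three measures: \<open>\<mu>\<close> is the joint law of two distances to the nearest integer, \<open>\<rho>\<close> the law
  under independence, and \<open>\<nu>\<close> the error term supported on a line. Passing from \<open>\<mu> \<otimes> \<mu>\<close> to \<open>\<rho> \<otimes> \<rho>\<close> one factor at a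
  time produces \<open>\<nu>\<close> errors integrated against \<open>\<mu>\<close>, which are again compared with \<open>\<rho>\<close> by symmetry of \<open>D\<close>.\<close>

lemma rectangle_comparison:
  fixes \<mu> \<rho> \<nu> :: "'a measure" and N :: "'a measure" and D :: "('a \<times> 'a) set"
  assumes fin: "finite_measure \<mu>" "finite_measure \<rho>" "finite_measure \<nu>"
    and sets: "sets \<mu> = sets N" "sets \<rho> = sets N" "sets \<nu> = sets N"
    and D: "D \<in> sets (N \<Otimes>\<^sub>M N)" and sym: "\<And>p r. (p, r) \<in> D \<longleftrightarrow> (r, p) \<in> D"
    and ub: "\<And>p. emeasure \<mu> (Pair p -` D) \<le> emeasure \<rho> (Pair p -` D) + emeasure \<nu> (Pair p -` D)"
    and lb: "\<And>p. emeasure \<rho> (Pair p -` D) \<le> emeasure \<mu> (Pair p -` D) + emeasure \<nu> (Pair p -` D)"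
  defines "E \<equiv> \<lambda>\<alpha> \<beta>. \<integral>\<^sup>+p. emeasure \<beta> (Pair p -` D) \<partial>\<alpha>"
  shows "E \<mu> \<mu> \<le> E \<rho> \<rho> + (2 * E \<nu> \<rho> + E \<nu> \<nu>)" and "E \<rho> \<rho> \<le> E \<mu> \<mu> + (2 * E \<nu> \<rho> + E \<nu> \<nu>)"
proof -
  have sym': "(\<lambda>x. (x, y)) -` D = Pair y -` D" for y using sym by auto
  have swap: "E \<alpha> \<beta> = E \<beta> \<alpha>"
    if "finite_measure \<alpha>" "finite_measure \<beta>" "sets \<alpha> = sets N" "sets \<beta> = sets N" for \<alpha> \<beta>
  proof -
    interpret A: finite_measure \<alpha> by fact
    interpret B: finite_measure \<beta> by fact
    interpret pair_sigma_finite \<alpha> \<beta> ..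
    have DD: "D \<in> sets (\<alpha> \<Otimes>\<^sub>M \<beta>)"
      using D sets_pair_measure_cong[OF that(3,4)] by simp
    show ?thesis
      unfolding E_def B.emeasure_pair_measure_alt[OF DD, symmetric] emeasure_pair_measure_alt2[OF DD] sym' ..
  qed
  have meas: "(\<lambda>p. emeasure \<beta> (Pair p -` D)) \<in> borel_measurable \<alpha>"
    if "finite_measure \<beta>" "sets \<alpha> = sets N" "sets \<beta> = sets N" for \<alpha> \<beta>
  proof -
    interpret B: finite_measure \<beta> by fact
    have "D \<in> sets (\<alpha> \<Otimes>\<^sub>M \<beta>)"
      using D sets_pair_measure_cong[OF that(2,3)] by simp
    then show ?thesis by (rule B.measurable_emeasure_Pair)
  qed
  have U: "E \<alpha> \<mu> \<le> E \<alpha> \<rho> + E \<alpha> \<nu>" if "sets \<alpha> = sets N" for \<alpha>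
    unfolding E_def using that fin sets
    by (subst nn_integral_add[symmetric]) (auto intro!: nn_integral_mono ub meas)
  have L: "E \<alpha> \<rho> \<le> E \<alpha> \<mu> + E \<alpha> \<nu>" if "sets \<alpha> = sets N" for \<alpha>
    unfolding E_def using that fin sets
    by (subst nn_integral_add[symmetric]) (auto intro!: nn_integral_mono lb meas)
  note swaps = swap[OF fin(1,2) sets(1,2)] swap[OF fin(1,3) sets(1,3)] swap[OF fin(2,3) sets(2,3)]
  \<comment> \<open>The error itself is still measured against \<open>\<mu>\<close>. Swapping the
    factors makes the upper bound applicable once more; this is the only source of
    \<open>E \<nu> \<nu>\<close>.\<close>
  have a: "E \<mu> \<nu> \<le> E \<nu> \<rho> + E \<nu> \<nu>" using U[OF sets(3)] swaps by simp
  have "E \<mu> \<mu> \<le> E \<rho> \<mu> + E \<mu> \<nu>" using U[OF sets(1)] swaps by simp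
  also have "\<dots> \<le> (E \<rho> \<rho> + E \<nu> \<rho>) + (E \<nu> \<rho> + E \<nu> \<nu>)"
    using U[OF sets(2)] swaps a by (intro add_mono) auto
  finally show "E \<mu> \<mu> \<le> E \<rho> \<rho> + (2 * E \<nu> \<rho> + E \<nu> \<nu>)" by (simp only: mult_2 add.assoc add.commute add.left_commute)
  have "E \<rho> \<rho> \<le> E \<mu> \<rho> + E \<nu> \<rho>" using L[OF sets(2)] swaps by simp
  also have "\<dots> \<le> (E \<mu> \<mu> + (E \<nu> \<rho> + E \<nu> \<nu>)) + E \<nu> \<rho>"
    using L[OF sets(1)] a by (intro add_mono order_trans[OF L[OF sets(1)]]) auto
  finally show "E \<rho> \<rho> \<le> E \<mu> \<mu> + (2 * E \<nu> \<rho> + E \<nu> \<nu>)" by (simp only: mult_2 add.assoc add.commute add.left_commute)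
qed

text \<open>The image of Lebesgue measure on \<open>A\<close>. The source space is left open because
  the three laws in use come from the unit interval, a square and a segment.\<close>

definition law :: "('a::euclidean_space \<Rightarrow> real \<times> real) \<Rightarrow> 'a set \<Rightarrow> (real \<times> real) measure" where
  "law f A = distr (density lborel (indicator A)) borel f"

lemma sets_law [simp, measurable_cong]: "sets (law f A) = sets borel"
  by (simp add: law_def)

lemma nn_integral_law:
  assumes [measurable]: "f \<in> borel_measurable borel" "A \<in> sets borel" "h \<in> borel_measurable borel"
  shows "(\<integral>\<^sup>+p. h p \<partial>law f A) = (\<integral>\<^sup>+x. h (f x) * indicator A x \<partial>lborel)"
  unfolding law_def by (subst nn_integral_distr) (auto simp: nn_integral_density ac_simps)

lemma emeasure_law:
  assumes "f \<in> borel_measurable borel" "A \<in> sets borel" "S \<in> sets borel"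
  shows "emeasure (law f A) S = (\<integral>\<^sup>+x. indicator S (f x) * indicator A x \<partial>lborel)"
  using nn_integral_law[OF assms(1,2), of "indicator S"] assms(3) by simp

lemma finite_measure_law:
  assumes f: "f \<in> borel_measurable borel" and A: "A \<in> sets borel" "emeasure lborel A < \<infinity>"
  shows "finite_measure (law f A)"
proof (rule finite_measureI)
  have "emeasure (law f A) UNIV = emeasure lborel A"
    using A by (simp add: emeasure_law[OF f])
  then show "emeasure (law f A) (space (law f A)) \<noteq> \<infinity>"
    using A by (simp add: law_def)
qed

text \<open>For y in \<open>[1, T)\<close> the slice of \<open>Omega\<close> is the set for b minus
  the set for a. Each of the two is stable under decreasing the absolute value of either coordinate,
  so its sections are intervals around 0.\<close>

definition hyp_star :: "real \<Rightarrow> real \<Rightarrow> real \<Rightarrow> (real \<times> real) set" where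
  "hyp_star b c y = {(u1, u2). max \<bar>u1\<bar> \<bar>u2\<bar> \<le> c \<and> \<bar>u1 * u2\<bar> * y \<le> b}"

text \<open>This is \<open>min c (b / (y s))\<close>, written so that \<open>s = 0\<close> gives \<open>c\<close> rather than a division by zero.\<close>

definition hyp_cut :: "real \<Rightarrow> real \<Rightarrow> real \<Rightarrow> real \<Rightarrow> real" where
  "hyp_cut b c y s = b / max (b / c) (y * s)"

lemma borel_measurable_hyp_cut [measurable]: "hyp_cut b c y \<in> borel_measurable borel"
  unfolding hyp_cut_def by measurable

lemma sets_hyp_star [measurable]: "hyp_star b c y \<in> sets borel"
  unfolding hyp_star_def split_beta by (intro borel_closed closed_Collect_conj closed_Collect_le continuous_intros)

lemma hyp_cut_iff:
  assumes "b > 0" "c > 0"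
  shows "0 \<le> r \<Longrightarrow> r \<le> hyp_cut b c y s \<longleftrightarrow> r \<le> c \<and> y * s * r \<le> b"
proof -
  assume "0 \<le> r"
  have "r \<le> hyp_cut b c y s \<longleftrightarrow> r * max (b / c) (y * s) \<le> b"
    using assms unfolding hyp_cut_def by (intro pos_le_divide_eq) (simp add: less_max_iff_disj)
  also have "\<dots> \<longleftrightarrow> r * (b / c) \<le> b \<and> r * (y * s) \<le> b"
    using \<open>0 \<le> r\<close> by (simp add: max_mult_distrib_left)
  also have "r * (b / c) \<le> b \<longleftrightarrow> r \<le> c"
    using assms by (simp add: field_simps)
  finally show ?thesis by (simp add: ac_simps)
qed

lemma hyp_cut_bounds:
  assumes "b > 0" "c > 0"
  shows "0 \<le> hyp_cut b c y s" "hyp_cut b c y s \<le> c"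
proof -
  show p: "0 \<le> hyp_cut b c y s" using assms by (simp add: hyp_cut_def le_max_iff_disj)
  show "hyp_cut b c y s \<le> c" using hyp_cut_iff[OF assms p] by auto
qed

lemma emeasure_hyp_star:
  assumes "b > 0" "c > 0" "y > 0"
  shows "emeasure lborel (hyp_star b c y) = (\<integral>\<^sup>+u. ennreal (2 * hyp_cut b c y \<bar>u\<bar>) * indicator {-c..c} u \<partial>lborel)"
proof -
  have *: "hyp_star b c y \<in> sets (lborel \<Otimes>\<^sub>M lborel)" unfolding lborel_prod sets_lborel by (rule sets_hyp_star)
  have sec: "emeasure lborel (Pair u -` hyp_star b c y) = ennreal (2 * hyp_cut b c y \<bar>u\<bar>) * indicator {-c..c} u" for u
  proof (cases "u \<in> {-c..c}")
    case True
    have "Pair u -` hyp_star b c y = {- hyp_cut b c y \<bar>u\<bar>..hyp_cut b c y \<bar>u\<bar>}"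
    proof (intro set_eqI)
      fix v
      have "v \<in> Pair u -` hyp_star b c y \<longleftrightarrow> \<bar>v\<bar> \<le> hyp_cut b c y \<bar>u\<bar>"
        using True by (subst hyp_cut_iff[OF assms(1,2)]) (auto simp: hyp_star_def abs_mult ac_simps)
      then show "v \<in> Pair u -` hyp_star b c y \<longleftrightarrow> v \<in> {- hyp_cut b c y \<bar>u\<bar>..hyp_cut b c y \<bar>u\<bar>}"
        by (auto simp: abs_le_iff)
    qed
    then show ?thesis using True hyp_cut_bounds[OF assms(1,2)] by simp
  next
    case False
    then have "Pair u -` hyp_star b c y = {}" by (auto simp: hyp_star_def)
    then show ?thesis using False by simp
  qed
  show ?thesis
    unfolding lborel_prod[symmetric] lborel.emeasure_pair_measure_alt[OF *] sec ..
qed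

text \<open>The first pair holds the first coordinates for \<open>y\<close> and \<open>y'\<close>, the second pair the second coordinates, so
  that the sections over the first pair are rectangles.\<close>

definition pair_star :: "real \<Rightarrow> real \<Rightarrow> real \<Rightarrow> real \<Rightarrow> ((real \<times> real) \<times> (real \<times> real)) set" where
  "pair_star b c y y' = {((s, s'), (r, r')). s \<in> {0..c} \<and> r \<in> {0..c} \<and> s' \<in> {0..c} \<and> r' \<in> {0..c}
      \<and> y * s * r \<le> b \<and> y' * s' * r' \<le> b}"

lemma sets_pair_star: "pair_star b c y y' \<in> sets (borel \<Otimes>\<^sub>M borel)"
  unfolding borel_prod pair_star_def split_beta atLeastAtMost_iff
  by (intro borel_closed closed_Collect_conj closed_Collect_le continuous_intros)

text \<open>Freezing the first coordinates decouples the constraints on r and r'. The section is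
  then a rectangle with a corner at the origin, the shape that \<open>overlap_bounds_min\<close>
  covers.\<close>

lemma pair_star_section:
  assumes "b > 0" "c > 0"
  shows "Pair (s, s') -` pair_star b c y y' =
     (if s \<in> {0..c} \<and> s' \<in> {0..c} then {0..hyp_cut b c y s} \<times> {0..hyp_cut b c y' s'} else {})"
  using hyp_cut_iff[OF assms] by (auto simp: pair_star_def)

lemma pair_star_sym: "(p, r) \<in> pair_star b c y y' \<longleftrightarrow> (r, p) \<in> pair_star b c y y'"
  by (auto simp: pair_star_def ac_simps)

lemma nn_integral_law_section:
  assumes f: "f \<in> borel_measurable borel" and A: "A \<in> sets borel" and fin: "finite_measure \<beta>"
    and sets: "sets \<beta> = sets borel" and D: "D \<in> sets (borel \<Otimes>\<^sub>M borel)"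
  shows "(\<integral>\<^sup>+p. emeasure \<beta> (Pair p -` D) \<partial>law f A) = (\<integral>\<^sup>+x. emeasure \<beta> (Pair (f x) -` D) * indicator A x \<partial>lborel)"
proof (rule nn_integral_law[OF f A])
  interpret finite_measure \<beta> by fact
  have "sets ((borel :: (real \<times> real) measure) \<Otimes>\<^sub>M \<beta>) = sets (borel \<Otimes>\<^sub>M borel)"
    by (intro sets_pair_measure_cong refl sets)
  then have "D \<in> sets (borel \<Otimes>\<^sub>M \<beta>)" using D by (simp only:)
  then show "(\<lambda>p. emeasure \<beta> (Pair p -` D)) \<in> borel_measurable borel"
    by (rule measurable_emeasure_Pair)
qed

section \<open>Masses of rectangles under independence and on the line\<close>

lemma sets_atLeastAtMost_Times [simp]: "{a..b} \<times> {c..d} \<in> sets (borel :: (real \<times> real) measure)"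
  by (intro borel_closed closed_Times) auto

lemma nn_integral_lborel_prod_mult:
  fixes f f' :: "real \<Rightarrow> ennreal"
  assumes [measurable]: "f \<in> borel_measurable borel" "f' \<in> borel_measurable borel"
  shows "(\<integral>\<^sup>+x. f (fst x) * f' (snd x) \<partial>lborel) = (\<integral>\<^sup>+x. f x \<partial>lborel) * (\<integral>\<^sup>+x. f' x \<partial>lborel)"
  unfolding lborel_prod[symmetric]
  by (subst lborel.nn_integral_fst[symmetric]) (auto simp: nn_integral_cmult nn_integral_multc)

lemma emeasure_law_abs:
  assumes "0 \<le> r" "r \<le> 1/2" "0 \<le> r'" "r' \<le> 1/2"
  shows "emeasure (law (\<lambda>u::real\<times>real. (\<bar>fst u\<bar>, \<bar>snd u\<bar>)) ({-1/2..1/2} \<times> {-1/2..1/2})) ({0..r} \<times> {0..r'})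
       = ennreal (4 * r * r')"
proof -
  have meas: "(\<lambda>u::real\<times>real. (\<bar>fst u\<bar>, \<bar>snd u\<bar>)) \<in> borel_measurable borel"
    by (intro borel_measurable_continuous_onI continuous_intros)
  have "emeasure (law (\<lambda>u::real\<times>real. (\<bar>fst u\<bar>, \<bar>snd u\<bar>)) ({-1/2..1/2} \<times> {-1/2..1/2})) ({0..r} \<times> {0..r'})
     = (\<integral>\<^sup>+u. indicator {-r..r} (fst u) * indicator {-r'..r'} (snd u) \<partial>lborel)"
    unfolding emeasure_law[OF meas sets_atLeastAtMost_Times sets_atLeastAtMost_Times]
    using assms by (intro nn_integral_cong) (auto simp: indicator_def split: if_splits)
  also have "\<dots> = ennreal (2 * r) * ennreal (2 * r')"
    using assms by (subst nn_integral_lborel_prod_mult) auto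
  also have "\<dots> = ennreal (4 * r * r')"
    using assms by (subst ennreal_mult[symmetric]) auto
  finally show ?thesis .
qed

text \<open>This mass is exactly the error term of \<open>overlap_bounds_min\<close>. Cutting the
  line to \<open>[-1, 1]\<close> keeps the measure finite and loses nothing, because
  \<open>r / m \<le> 1\<close>.\<close>

lemma emeasure_law_line:
  fixes m m' :: nat
  assumes "m > 0" "m' > 0" "0 \<le> r" "r \<le> 1/2" "0 \<le> r'" "r' \<le> 1/2"
  shows "emeasure (law (\<lambda>t::real. (real m * \<bar>t\<bar>, real m' * \<bar>t\<bar>)) {-1..1}) ({0..r} \<times> {0..r'})
       = ennreal (2 * min (r / m) (r' / m'))"
proof -
  let ?z = "min (r / m) (r' / m')"
  have meas: "(\<lambda>t::real. (real m * \<bar>t\<bar>, real m' * \<bar>t\<bar>)) \<in> borel_measurable borel"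
    by (intro borel_measurable_continuous_onI continuous_intros)
  have 0: "0 \<le> ?z" using assms by simp
  have "r / m \<le> 1" using assms by (simp add: field_simps)
  then have 1: "?z \<le> 1" by (simp add: min_le_iff_disj)
  have "emeasure (law (\<lambda>t::real. (real m * \<bar>t\<bar>, real m' * \<bar>t\<bar>)) {-1..1}) ({0..r} \<times> {0..r'})
     = (\<integral>\<^sup>+t. indicator ({0..r} \<times> {0..r'}) (real m * \<bar>t\<bar>, real m' * \<bar>t\<bar>) * indicator {-1..1} t \<partial>lborel)"
    by (rule emeasure_law[OF meas _ sets_atLeastAtMost_Times]) simp
  also have "\<dots> = (\<integral>\<^sup>+t. indicator {-?z..?z} t \<partial>lborel)"
  proof (intro nn_integral_cong)
    fix t :: real
    have "real m * \<bar>t\<bar> \<le> r \<and> real m' * \<bar>t\<bar> \<le> r' \<longleftrightarrow> \<bar>t\<bar> \<le> ?z"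
      using assms by (simp add: pos_le_divide_eq ac_simps)
    also have "\<dots> \<longleftrightarrow> t \<in> {-?z..?z}" by (simp only: abs_le_iff atLeastAtMost_iff) linarith
    finally have iff: "real m * \<bar>t\<bar> \<le> r \<and> real m' * \<bar>t\<bar> \<le> r' \<longleftrightarrow> t \<in> {-?z..?z}" .
    have "t \<in> {-1..1}" if "t \<in> {-?z..?z}" using that 1 by (simp only: atLeastAtMost_iff) linarith
    with iff show "indicator ({0..r} \<times> {0..r'}) (real m * \<bar>t\<bar>, real m' * \<bar>t\<bar>) * indicator {-1..1} t
       = (indicator {-?z..?z} t :: ennreal)"
      unfolding indicator_def by (auto simp del: atLeastAtMost_iff simp: mem_Times_iff) (auto)
  qed
  also have "\<dots> = ennreal (2 * ?z)"
    using 0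
    by (subst nn_integral_indicator, simp, subst emeasure_lborel_Icc, linarith) (simp only: diff_minus_eq_add mult_2)
  finally show ?thesis .
qed

text \<open>On the line the distance is \<open>m * |t|\<close> at height \<open>g * m\<close>, with
  product \<open>g * m^2 * |t|\<close>; this dependence on g produces the factor 1/g that is summed
  later. Lowering \<open>b / c\<close> to b removes c from the error.\<close>

lemma hyp_cut_scaled_le:
  assumes "b > 0" "0 < c" "c < 1/2"
  shows "hyp_cut b c (real (g * m)) (real m * \<bar>t\<bar>) \<le> b / max b (real g * (real m)\<^sup>2 * \<bar>t\<bar>)"
proof -
  have "b \<le> b / c" using assms by (simp add: field_simps)
  then have "max b (real g * (real m)\<^sup>2 * \<bar>t\<bar>) \<le> max (b / c) (real (g * m) * (real m * \<bar>t\<bar>))"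
    by (intro max.mono) (auto simp: power2_eq_square ac_simps)
  then show ?thesis unfolding hyp_cut_def
    using assms by (intro divide_left_mono) (auto simp: less_max_iff_disj)
qed

text \<open>The coordinates of x are independent, so the joint event is \<open>pair_star\<close>
  tested against two copies of \<open>\<mu>\<close>, and \<open>rectangle_comparison\<close>
  applies. In the integrand, \<open>8 = 2 * 4\<close> comes from \<open>\<nu>\<close> against
  \<open>\<rho>\<close>, counted twice, and the minimum from \<open>\<nu>\<close> against
  itself.\<close>

lemma covariance_bounds:
  fixes g m m' :: nat and b c :: real
  assumes b: "b > 0" and c: "0 < c" "c < 1/2"
    and pos: "g > 0" "m > 0" "m' > 0" and cop: "coprime m m'"
  defines "W \<equiv> \<lambda>y. emeasure lborel (hyp_star b c y)"
    and "k \<equiv> \<lambda>i t. b / max b (real g * (real i)\<^sup>2 * \<bar>t\<bar>)"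
    and "hit \<equiv> \<lambda>q x. indicator (hyp_star b c (real q)) (dist_nearest_int (real q * fst x), dist_nearest_int (real q * snd x)) :: ennreal"
  defines "E \<equiv> \<integral>\<^sup>+x. hit (g * m) x * hit (g * m') x * indicator ({0..<1} \<times> {0..<1}) x \<partial>lborel"
    and "K \<equiv> \<integral>\<^sup>+t. ennreal (8 * k m t * k m' t + 2 * min (k m t / m) (k m' t / m')) * indicator {-1..1} t \<partial>lborel"
  shows "E \<le> W (g * m) * W (g * m') + K" and "W (g * m) * W (g * m') \<le> E + K"
proof -
  let ?q = "real (g * m)" and ?q' = "real (g * m')"
  define D where "D = pair_star b c ?q ?q'"
  define F where "F x = (dist_nearest_int (?q * x), dist_nearest_int (?q' * x))" for x
  define \<mu> where "\<mu> = law F {0..<1}"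
  define \<rho> where "\<rho> = law (\<lambda>u::real\<times>real. (\<bar>fst u\<bar>, \<bar>snd u\<bar>)) ({-1/2..1/2} \<times> {-1/2..1/2})"
  define \<nu> where "\<nu> = law (\<lambda>t::real. (real m * \<bar>t\<bar>, real m' * \<bar>t\<bar>)) {-1..1}"
  have F [measurable]: "F \<in> borel_measurable borel"
    unfolding F_def borel_prod[symmetric] by measurable
  have hit_meas [measurable]: "hit q \<in> borel_measurable borel" for q
  proof -
    have "(\<lambda>x::real\<times>real. (dist_nearest_int (real q * fst x), dist_nearest_int (real q * snd x))) \<in> borel \<rightarrow>\<^sub>M borel"
      unfolding borel_prod[symmetric] by measurable
    then show ?thesis unfolding hit_def
      by (rule measurable_compose) (simp add: borel_measurable_indicator sets_hyp_star)
  qed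
  have absm: "(\<lambda>u::real\<times>real. (\<bar>fst u\<bar>, \<bar>snd u\<bar>)) \<in> borel_measurable borel"
    and linem: "(\<lambda>t::real. (real m * \<bar>t\<bar>, real m' * \<bar>t\<bar>)) \<in> borel_measurable borel"
    by (intro borel_measurable_continuous_onI continuous_intros)+
  have qpos: "?q > 0" "?q' > 0" using pos by simp_all
  have sets: "sets \<mu> = sets borel" "sets \<rho> = sets borel" "sets \<nu> = sets borel"
    by (simp_all add: \<mu>_def \<rho>_def \<nu>_def)
  have D: "D \<in> sets (borel \<Otimes>\<^sub>M borel)" unfolding D_def by (rule sets_pair_star)
  have box: "emeasure lborel ({-1/2..1/2::real} \<times> {-1/2..1/2::real}) < \<infinity>"
    unfolding lborel_prod[symmetric] by (subst lborel.emeasure_pair_measure_Times) (auto simp: ennreal_mult_less_top)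
  have fin: "finite_measure \<mu>" "finite_measure \<rho>" "finite_measure \<nu>"
    unfolding \<mu>_def \<rho>_def \<nu>_def using box by (auto intro!: finite_measure_law F absm linem)
  have \<mu>rect: "emeasure \<mu> ({0..r} \<times> {0..r'}) = emeasure lborel {x\<in>{0..<1}. dist_nearest_int (?q * x) \<le> r
                                \<and> dist_nearest_int (?q' * x) \<le> r'}" for r r'
  proof -
    have "emeasure \<mu> ({0..r} \<times> {0..r'}) = (\<integral>\<^sup>+x. indicator ({0..r} \<times> {0..r'}) (F x) * indicator {0..<1} x \<partial>lborel)"
      unfolding \<mu>_def by (rule emeasure_law[OF F]) auto
    also have "\<dots> = (\<integral>\<^sup>+x. indicator {x\<in>{0..<1}. dist_nearest_int (?q * x) \<le> r
                                \<and> dist_nearest_int (?q' * x) \<le> r'} x \<partial>lborel)"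
      by (intro nn_integral_cong) (auto simp: F_def indicator_def)
    also have "\<dots> = emeasure lborel {x\<in>{0..<1}. dist_nearest_int (?q * x) \<le> r
                                \<and> dist_nearest_int (?q' * x) \<le> r'}"
      by (rule nn_integral_indicator) measurable
    finally show ?thesis .
  qed
  have \<rho>rect: "emeasure \<rho> ({0..r} \<times> {0..r'}) = ennreal (4 * r * r')"
    if "0 \<le> r" "r \<le> 1/2" "0 \<le> r'" "r' \<le> 1/2" for r r'
    unfolding \<rho>_def using that by (rule emeasure_law_abs)
  have \<nu>rect: "emeasure \<nu> ({0..r} \<times> {0..r'}) = ennreal (2 * min (r / m) (r' / m'))"
    if "0 \<le> r" "r \<le> 1/2" "0 \<le> r'" "r' \<le> 1/2" for r r'
    unfolding \<nu>_def using pos(2,3) that by (rule emeasure_law_line)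
  note cut = hyp_cut_bounds[OF b c(1)]
  have cut_half: "hyp_cut b c y s \<le> 1/2" "hyp_cut b c y s < 1/2" for y s using cut(2)[of y s] c by auto
  note \<rho>cut = \<rho>rect[OF cut(1) cut_half(1) cut(1) cut_half(1)]
  note \<nu>cut = \<nu>rect[OF cut(1) cut_half(1) cut(1) cut_half(1)]
  have ub: "emeasure \<mu> (Pair p -` D) \<le> emeasure \<rho> (Pair p -` D) + emeasure \<nu> (Pair p -` D)"
   and lb: "emeasure \<rho> (Pair p -` D) \<le> emeasure \<mu> (Pair p -` D) + emeasure \<nu> (Pair p -` D)" for p
    unfolding atomize_conj
  proof (cases p)
    case (Pair s s')
    show "emeasure \<mu> (Pair p -` D) \<le> emeasure \<rho> (Pair p -` D) + emeasure \<nu> (Pair p -` D)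
        \<and> emeasure \<rho> (Pair p -` D) \<le> emeasure \<mu> (Pair p -` D) + emeasure \<nu> (Pair p -` D)"
      unfolding Pair D_def pair_star_section[OF b c(1)]
      using overlap_bounds_min[OF pos cop cut(1)[of ?q s] cut_half(2)[of ?q s] cut(1)[of ?q' s'] cut_half(2)[of ?q' s']]
      by (simp only: \<mu>rect \<rho>cut \<nu>cut split: if_split) simp
  qed
  define I where "I \<alpha> \<beta> = (\<integral>\<^sup>+p. emeasure \<beta> (Pair p -` D) \<partial>\<alpha>)" for \<alpha> \<beta> :: "(real \<times> real) measure"
  have cmp: "I \<mu> \<mu> \<le> I \<rho> \<rho> + (2 * I \<nu> \<rho> + I \<nu> \<nu>)" "I \<rho> \<rho> \<le> I \<mu> \<mu> + (2 * I \<nu> \<rho> + I \<nu> \<nu>)"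
    unfolding I_def D_def
    by (rule rectangle_comparison[OF fin sets sets_pair_star pair_star_sym ub[unfolded D_def] lb[unfolded D_def]])+

  \<comment> \<open>The two events are regrouped by coordinate: the distances for q and q' in the
    first coordinate form one point with law \<open>\<mu>\<close>, those in the second coordinate
    another.\<close>
  have I\<mu>: "I \<mu> \<mu> = E"
  proof -
    define G where "G x = hit (g * m) x * hit (g * m') x * indicator ({0..<1} \<times> {0..<1}) x" for x
    have [measurable]: "({0..<1} \<times> {0..<1}) \<in> sets (borel :: (real \<times> real) measure)"
      unfolding borel_prod[symmetric] by measurable
    have G: "G \<in> borel_measurable (lborel \<Otimes>\<^sub>M lborel)"
      unfolding G_def lborel_prod by measurable
    have "E = (\<integral>\<^sup>+x. G x \<partial>(lborel \<Otimes>\<^sub>M lborel))"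
      by (simp only: E_def G_def lborel_prod)
    also have "\<dots> = (\<integral>\<^sup>+x. \<integral>\<^sup>+y. G (x, y) \<partial>lborel \<partial>lborel)"
      by (rule lborel.nn_integral_fst[OF G, symmetric])
    also have "\<dots> = (\<integral>\<^sup>+x. \<integral>\<^sup>+y. indicator (Pair (F x) -` D) (F y) * indicator {0..<1} y * indicator {0..<1} x \<partial>lborel \<partial>lborel)"
      using c by (intro nn_integral_cong)
        (auto simp: G_def hit_def F_def D_def pair_star_def hyp_star_def indicator_def abs_mult ac_simps)
    also have "\<dots> = (\<integral>\<^sup>+x. (\<integral>\<^sup>+y. indicator (Pair (F x) -` D) (F y) * indicator {0..<1} y \<partial>lborel) * indicator {0..<1} x \<partial>lborel)"
    proof (intro nn_integral_cong nn_integral_multc)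
      fix x
      have [measurable]: "Pair (F x) -` D \<in> sets borel" by (rule sets_Pair1[OF D])
      show "(\<lambda>y. indicator (Pair (F x) -` D) (F y) * indicator {0..<1} y :: ennreal) \<in> borel_measurable lborel"
        by measurable
    qed
    also have "\<dots> = (\<integral>\<^sup>+x. emeasure \<mu> (Pair (F x) -` D) * indicator {0..<1} x \<partial>lborel)"
      unfolding \<mu>_def by (subst emeasure_law[OF F _ sets_Pair1[OF D]]) auto
    also have "\<dots> = I \<mu> \<mu>"
      unfolding I_def using nn_integral_law_section[OF F _ fin(1) sets(1) D, of "{0..<1}"] by (simp add: \<mu>_def)
    finally show ?thesis ..
  qed

  \<comment> \<open>The section mass is a product of two lengths, each a section length of one
    planar star, so the integral factors into two areas.\<close>
  have I\<rho>: "I \<rho> \<rho> = W (g * m) * W (g * m')"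
  proof -
    have "I \<rho> \<rho> = (\<integral>\<^sup>+u. emeasure \<rho> (Pair (\<bar>fst u\<bar>, \<bar>snd u\<bar>) -` D) * indicator ({-1/2..1/2} \<times> {-1/2..1/2}) u \<partial>lborel)"
      unfolding I_def
      using nn_integral_law_section[OF absm sets_atLeastAtMost_Times fin(2) sets(2) D] by (simp add: \<rho>_def)
    also have "\<dots> = (\<integral>\<^sup>+u. (ennreal (2 * hyp_cut b c ?q \<bar>fst u\<bar>) * indicator {-c..c} (fst u))
          * (ennreal (2 * hyp_cut b c ?q' \<bar>snd u\<bar>) * indicator {-c..c} (snd u)) \<partial>lborel)"
    proof (intro nn_integral_cong)
      fix u :: "real \<times> real"
      have mult: "ennreal (2 * hyp_cut b c ?q \<bar>fst u\<bar>) * ennreal (2 * hyp_cut b c ?q' \<bar>snd u\<bar>)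
          = ennreal (4 * hyp_cut b c ?q \<bar>fst u\<bar> * hyp_cut b c ?q' \<bar>snd u\<bar>)"
        by (subst ennreal_mult[symmetric]) (auto simp: cut)
      show "emeasure \<rho> (Pair (\<bar>fst u\<bar>, \<bar>snd u\<bar>) -` D) * indicator ({-1/2..1/2} \<times> {-1/2..1/2}) u
         = (ennreal (2 * hyp_cut b c ?q \<bar>fst u\<bar>) * indicator {-c..c} (fst u))
          * (ennreal (2 * hyp_cut b c ?q' \<bar>snd u\<bar>) * indicator {-c..c} (snd u))"
      proof (cases "\<bar>fst u\<bar> \<le> c \<and> \<bar>snd u\<bar> \<le> c")
        case True
        then have "fst u \<in> {-c..c}" "snd u \<in> {-c..c}" "u \<in> {-1/2..1/2} \<times> {-1/2..1/2}"
          using c by (auto simp: mem_Times_iff)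
        then show ?thesis using True mult
          by (simp add: D_def pair_star_section[OF b c(1)] \<rho>cut cut)
      next
        case False
        then have "fst u \<notin> {-c..c} \<or> snd u \<notin> {-c..c}" by auto
        then show ?thesis using False
          by (auto simp: D_def pair_star_section[OF b c(1)])
      qed
    qed
    also have "\<dots> = W (g * m) * W (g * m')"
      unfolding W_def emeasure_hyp_star[OF b c(1) qpos(1)] emeasure_hyp_star[OF b c(1) qpos(2)]
      by (rule nn_integral_lborel_prod_mult) measurable
    finally show ?thesis .
  qed

  have k: "hyp_cut b c ?q (real m * \<bar>t\<bar>) \<le> k m t" "hyp_cut b c ?q' (real m' * \<bar>t\<bar>) \<le> k m' t" for t
    unfolding k_def using hyp_cut_scaled_le[OF b c] by blast+
  have [measurable]: "k i \<in> borel_measurable borel" for i unfolding k_def by measurable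
  have k0: "0 \<le> k i t" for i t using b by (simp add: k_def le_max_iff_disj)
  have I\<nu>\<rho>: "I \<nu> \<rho> \<le> (\<integral>\<^sup>+t. ennreal (4 * k m t * k m' t) * indicator {-1..1} t \<partial>lborel)"
  proof -
    have "I \<nu> \<rho> = (\<integral>\<^sup>+t. emeasure \<rho> (Pair (real m * \<bar>t\<bar>, real m' * \<bar>t\<bar>) -` D) * indicator {-1..1} t \<partial>lborel)"
      unfolding I_def using nn_integral_law_section[OF linem _ fin(2) sets(2) D, of "{-1..1}"] by (simp add: \<nu>_def)
    also have "\<dots> \<le> (\<integral>\<^sup>+t. ennreal (4 * k m t * k m' t) * indicator {-1..1} t \<partial>lborel)"
      using k k0 cut
      by (intro nn_integral_mono mult_right_mono)
        (auto simp: D_def pair_star_section[OF b c(1)] \<rho>cut cut intro!: ennreal_leI mult_mono)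
    finally show ?thesis .
  qed
  have I\<nu>\<nu>: "I \<nu> \<nu> \<le> (\<integral>\<^sup>+t. ennreal (2 * min (k m t / m) (k m' t / m')) * indicator {-1..1} t \<partial>lborel)"
  proof -
    have mm: "min (hyp_cut b c ?q (real m * \<bar>t\<bar>) / m) (hyp_cut b c ?q' (real m' * \<bar>t\<bar>) / m')
        \<le> min (k m t / m) (k m' t / m')" for t
      by (intro min.mono divide_right_mono k) auto
    have "I \<nu> \<nu> = (\<integral>\<^sup>+t. emeasure \<nu> (Pair (real m * \<bar>t\<bar>, real m' * \<bar>t\<bar>) -` D) * indicator {-1..1} t \<partial>lborel)"
      unfolding I_def using nn_integral_law_section[OF linem _ fin(3) sets(3) D, of "{-1..1}"] by (simp add: \<nu>_def)
    also have "\<dots> \<le> (\<integral>\<^sup>+t. ennreal (2 * min (k m t / m) (k m' t / m')) * indicator {-1..1} t \<partial>lborel)"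
      using mm
      by (intro nn_integral_mono mult_right_mono)
        (auto simp: D_def pair_star_section[OF b c(1)] \<nu>cut intro!: ennreal_leI)
    finally show ?thesis .
  qed
  have "2 * I \<nu> \<rho> + I \<nu> \<nu> \<le> 2 * (\<integral>\<^sup>+t. ennreal (4 * k m t * k m' t) * indicator {-1..1} t \<partial>lborel)
     + (\<integral>\<^sup>+t. ennreal (2 * min (k m t / m) (k m' t / m')) * indicator {-1..1} t \<partial>lborel)"
    using I\<nu>\<rho> I\<nu>\<nu> by (intro add_mono mult_left_mono) auto
  also have "\<dots> = (\<integral>\<^sup>+t. 2 * (ennreal (4 * k m t * k m' t) * indicator {-1..1} t) \<partial>lborel)
     + (\<integral>\<^sup>+t. ennreal (2 * min (k m t / m) (k m' t / m')) * indicator {-1..1} t \<partial>lborel)"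
    by (subst nn_integral_cmult) measurable
  also have "\<dots> = (\<integral>\<^sup>+t. 2 * (ennreal (4 * k m t * k m' t) * indicator {-1..1} t)
     + ennreal (2 * min (k m t / m) (k m' t / m')) * indicator {-1..1} t \<partial>lborel)"
    by (rule nn_integral_add[symmetric]) measurable
  also have "\<dots> = K"
    unfolding K_def
  proof (intro nn_integral_cong)
    fix t
    have "ennreal (8 * k m t * k m' t + 2 * min (k m t / m) (k m' t / m'))
      = ennreal (2 * (4 * k m t * k m' t)) + ennreal (2 * min (k m t / m) (k m' t / m'))"
      using k0 by (subst ennreal_plus[symmetric]) auto
    also have "ennreal (2 * (4 * k m t * k m' t)) = 2 * ennreal (4 * k m t * k m' t)"
      using k0 by (subst ennreal_mult) auto
    finally show "2 * (ennreal (4 * k m t * k m' t) * indicator {-1..1} t)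
     + ennreal (2 * min (k m t / m) (k m' t / m')) * indicator {-1..1} t
     = ennreal (8 * k m t * k m' t + 2 * min (k m t / m) (k m' t / m')) * indicator {-1..1} t"
      by (simp add: distrib_right mult.assoc)
  qed
  finally have stuff: "2 * I \<nu> \<rho> + I \<nu> \<nu> \<le> K" .
  show "E \<le> W (g * m) * W (g * m') + K" "W (g * m) * W (g * m') \<le> E + K"
    using cmp stuff unfolding I\<mu> I\<rho> by (meson add_left_mono order_trans)+
qed

section \<open>Summing the covariance bounds\<close>

text \<open>The core \<open>|t| \<le> \<delta>\<close> contributes 2, and each of the two tails
  contributes \<open>ln (1 / \<delta>)\<close>.\<close>

lemma nn_integral_inverse_max_le:
  assumes "0 < \<delta>" "\<delta> \<le> 1"
  shows "(\<integral>\<^sup>+t. ennreal (1 / max \<delta> \<bar>t\<bar>) * indicator {-1..1} t \<partial>lborel) \<le> ennreal (2 * (1 + ln (1 / \<delta>)))"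
proof -
  have ftc: "(\<integral>\<^sup>+t. ennreal (1 / t) * indicator {\<delta>..1} t \<partial>lborel) = ennreal (ln (1 / \<delta>))"
  proof -
    have "(\<integral>\<^sup>+t. ennreal (1 / t) * indicator {\<delta>..1} t \<partial>lborel) = ennreal (ln 1 - ln \<delta>)"
      using assms by (intro nn_integral_FTC_Icc) (auto intro!: derivative_eq_intros)
    then show ?thesis using assms by (simp add: ln_div)
  qed
  have reflected: "(\<integral>\<^sup>+t. ennreal (1 / - t) * indicator {\<delta>..1} (- t) \<partial>lborel) = ennreal (ln (1 / \<delta>))"
    using nn_integral_real_affine[of "\<lambda>t. ennreal (1 / t) * indicator {\<delta>..1} t" "-1" 0] ftc by simp
  have "(\<integral>\<^sup>+t. ennreal (1 / max \<delta> \<bar>t\<bar>) * indicator {-1..1} t \<partial>lborel)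
     \<le> (\<integral>\<^sup>+t. ennreal (1 / \<delta>) * indicator {-\<delta>..\<delta>} t
          + (ennreal (1 / t) * indicator {\<delta>..1} t + ennreal (1 / - t) * indicator {\<delta>..1} (- t)) \<partial>lborel)"
    using assms by (intro nn_integral_mono) (auto simp: indicator_def max_def)
  also have "\<dots> = (\<integral>\<^sup>+t. ennreal (1 / \<delta>) * indicator {-\<delta>..\<delta>} t \<partial>lborel)
      + ((\<integral>\<^sup>+t. ennreal (1 / t) * indicator {\<delta>..1} t \<partial>lborel)
      + (\<integral>\<^sup>+t. ennreal (1 / - t) * indicator {\<delta>..1} (- t) \<partial>lborel))"
    by (subst nn_integral_add, measurable, subst nn_integral_add) measurable
  also have "(\<integral>\<^sup>+t. ennreal (1 / \<delta>) * indicator {-\<delta>..\<delta>} t \<partial>lborel) = ennreal 2"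
    using assms by (subst nn_integral_cmult) (auto simp flip: ennreal_mult)
  also have "ennreal 2 + ((\<integral>\<^sup>+t. ennreal (1 / t) * indicator {\<delta>..1} t \<partial>lborel)
      + (\<integral>\<^sup>+t. ennreal (1 / - t) * indicator {\<delta>..1} (- t) \<partial>lborel))
      = ennreal (2 + (ln (1 / \<delta>) + ln (1 / \<delta>)))"
  proof -
    have "0 \<le> ln (1 / \<delta>)" using assms by (intro ln_ge_zero) simp
    then show ?thesis unfolding ftc reflected by (simp only: ennreal_plus add_nonneg_nonneg zero_le_numeral)
  qed
  finally show ?thesis by (simp add: algebra_simps)
qed

section \<open>Elementary sums of the cutoff functions\<close>

lemma sum_inverse_squares_le: "(\<Sum>i=1..N. 1 / (real i)\<^sup>2) \<le> 2"
proof -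
  have bound: "(\<Sum>i=1..Suc n. 1 / (real i)\<^sup>2) \<le> 2 - 1 / real (Suc n)" for n
  proof (induction n)
    case (Suc n)
    have "1 / (real (Suc (Suc n)))\<^sup>2 \<le> 1 / (real (Suc n) * real (Suc (Suc n)))"
      unfolding power2_eq_square by (intro divide_left_mono mult_right_mono) auto
    also have "\<dots> = 1 / real (Suc n) - 1 / real (Suc (Suc n))"
      by (simp add: field_simps)
    finally have "1 / (real (Suc (Suc n)))\<^sup>2 \<le> 1 / real (Suc n) - 1 / real (Suc (Suc n))" .
    then show ?case using Suc by simp
  qed simp
  show ?thesis
  proof (cases N)
    case (Suc n)
    have "2 - 1 / real (Suc n) \<le> 2" by simp
    with bound[of n] show ?thesis unfolding Suc by (rule order_trans)
  qed simp
qed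

text \<open>The summand is at most \<open>4\<close> times an increment of \<open>K i / (K + i)\<close>, where
  \<open>K\<^sup>2 = b / (g x)\<close> is the point at which the maximum switches.\<close>

lemma sum_cutoff_sqrt_le:
  fixes b g x :: real
  assumes "b > 0" "g > 0" "x > 0"
  shows "(\<Sum>i=1..N. b / max b (g * (real i)\<^sup>2 * x)) \<le> 4 * sqrt (b / (g * x))"
proof -
  define K where "K = sqrt (b / (g * x))"
  have K: "K > 0" "K\<^sup>2 = b / (g * x)" using assms by (auto simp: K_def)
  have b: "b = K\<^sup>2 * (g * x)" using K(2) assms by simp
  have step: "b / max b (g * (real (Suc i))\<^sup>2 * x) \<le> 4 * (K * real (Suc i) / (K + real (Suc i)) - K * real i / (K + real i))" for i
  proof -
    let ?s = "real (Suc i)"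
    have "b / max b (g * ?s\<^sup>2 * x) = K\<^sup>2 / max (K\<^sup>2) (?s\<^sup>2)"
    proof -
      have "max b (g * ?s\<^sup>2 * x) = (g * x) * max (K\<^sup>2) (?s\<^sup>2)"
        using assms by (subst max_mult_distrib_left) (simp add: b ac_simps)
      then show ?thesis using assms unfolding b by simp
    qed
    \<comment> \<open>Trading the maximum for \<open>(K + s)^2\<close> costs the factor 4. The
      resulting rational function telescopes once one factor \<open>K + s\<close> is lowered to
      \<open>K + i\<close>.\<close>
    also have "\<dots> \<le> 4 * (K\<^sup>2 / (K + ?s)\<^sup>2)"
    proof -
      have "(K + ?s)\<^sup>2 \<le> 2 * K\<^sup>2 + 2 * ?s\<^sup>2" using sum_squares_bound[of K ?s] by (simp add: power2_sum)
      also have "\<dots> \<le> 4 * max (K\<^sup>2) (?s\<^sup>2)" by simp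
      finally have "K\<^sup>2 / (4 * max (K\<^sup>2) (?s\<^sup>2)) \<le> K\<^sup>2 / (K + ?s)\<^sup>2"
        using K(1) by (intro divide_left_mono mult_pos_pos) (auto simp: less_max_iff_disj)
      then show ?thesis by simp
    qed
    also have "\<dots> \<le> 4 * (K\<^sup>2 / ((K + ?s) * (K + real i)))"
      using K(1) unfolding power2_eq_square[of "K + ?s"]
      by (intro mult_left_mono divide_left_mono) (auto intro!: mult_pos_pos)
    also have "K\<^sup>2 / ((K + ?s) * (K + real i)) = K * ?s / (K + ?s) - K * real i / (K + real i)"
    proof -
      have "K + ?s \<noteq> 0" "K + real i \<noteq> 0" using K by auto
      then show ?thesis by (subst diff_frac_eq) (auto simp: power2_eq_square algebra_simps)
    qed
    finally show ?thesis .
  qed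
  have "(\<Sum>i=1..N. b / max b (g * (real i)\<^sup>2 * x)) \<le> 4 * (K * real N / (K + real N))"
  proof (induction N)
    case (Suc N)
    then show ?case using step[of N] by (simp add: algebra_simps)
  qed simp
  also have "\<dots> \<le> 4 * K" using K by (simp add: field_simps)
  finally show ?thesis by (simp add: K_def)
qed

text \<open>\<open>J\<close> is the minimum of \<open>N^2\<close> and \<open>b / (g x)\<close>,
  written so that \<open>x = 0\<close> gives \<open>N^2\<close>. Hence a nonnegative quantity is at
  most \<open>J\<close> once it is at most \<open>N^2\<close> and its product with x is at most
  \<open>b / g\<close>. The 16 is the square of the 4 in \<open>sum_cutoff_sqrt_le\<close>; the 2
  bounds the sum of the inverse squares.\<close>

lemma sum_cutoff_bounds:
  fixes b g x :: real
  assumes "b > 0" "g > 0" "x \<ge> 0" "N \<ge> 1"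
  defines "S \<equiv> \<Sum>i=1..N. b / max b (g * (real i)\<^sup>2 * x)"
    and "J \<equiv> (b / g) * (1 / max (b / g / (real N)\<^sup>2) x)"
  shows "S\<^sup>2 \<le> 16 * J" and "S \<le> 2 * J"
proof -
  have S0: "0 \<le> S" unfolding S_def using assms by (intro sum_nonneg) (auto simp: le_max_iff_disj)
  have "S \<le> (\<Sum>i=1..N. 1)"
    unfolding S_def using assms by (intro sum_mono) (auto simp: divide_le_eq_1 less_max_iff_disj)
  then have SN: "S \<le> real N" by simp
  have J: "y \<le> J" if "y \<le> (real N)\<^sup>2" "y * x \<le> b / g" "0 \<le> y" for y
  proof -
    have "y * (b / g / (real N)\<^sup>2) \<le> (real N)\<^sup>2 * (b / g / (real N)\<^sup>2)"
      using that assms by (intro mult_right_mono) auto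
    then have "y * (b / g / (real N)\<^sup>2) \<le> b / g" using assms by simp
    then have "y * max (b / g / (real N)\<^sup>2) x \<le> b / g"
      using that by (simp add: max_mult_distrib_left)
    moreover have "0 < max (b / g / (real N)\<^sup>2) x" using assms by (simp add: less_max_iff_disj)
    ultimately have "y \<le> (b / g) / max (b / g / (real N)\<^sup>2) x" by (simp only: pos_le_divide_eq)
    then show ?thesis unfolding J_def by (simp only: times_divide_eq_right mult_1_right)
  qed
  show "S\<^sup>2 \<le> 16 * J"
  proof -
    have "S\<^sup>2 / 16 \<le> J"
    proof (rule J)
      show "S\<^sup>2 / 16 \<le> (real N)\<^sup>2" using power_mono[OF SN S0, of 2] zero_le_power2[of "real N"] by linarith
      show "S\<^sup>2 / 16 * x \<le> b / g"
      proof (cases "x = 0")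
        case False
        then have "S \<le> 4 * sqrt (b / (g * x))"
          unfolding S_def using assms by (intro sum_cutoff_sqrt_le) auto
        then have "S\<^sup>2 \<le> (4 * sqrt (b / (g * x)))\<^sup>2" using S0 by (intro power_mono)
        also have "\<dots> = 16 * (b / (g * x))" using assms by (simp add: power_mult_distrib)
        finally have "S\<^sup>2 / 16 \<le> b / (g * x)" by linarith
        then have "S\<^sup>2 / 16 * x \<le> b / (g * x) * x" by (rule mult_right_mono) fact
        then show ?thesis using False by simp
      qed (use assms in auto)
    qed simp
    then show ?thesis by simp
  qed
  show "S \<le> 2 * J"
  proof -
    have "S / 2 \<le> J"
    proof (rule J)
      have "real N \<le> (real N)\<^sup>2" using assms by (simp add: power2_eq_square)
      then show "S / 2 \<le> (real N)\<^sup>2" using SN S0 by linarith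
      have "S * x = (\<Sum>i=1..N. b / max b (g * (real i)\<^sup>2 * x) * x)" unfolding S_def sum_distrib_right ..
      also have "\<dots> \<le> (\<Sum>i=1..N. (b / g) * (1 / (real i)\<^sup>2))"
      proof (rule sum_mono)
        fix i assume i: "i \<in> {1..N}"
        show "b / max b (g * (real i)\<^sup>2 * x) * x \<le> (b / g) * (1 / (real i)\<^sup>2)"
        proof (cases "x = 0")
          case False
          then have "b / max b (g * (real i)\<^sup>2 * x) * x \<le> b / (g * (real i)\<^sup>2 * x) * x"
            using assms i by (intro mult_right_mono divide_left_mono) (auto simp: less_max_iff_disj)
          then show ?thesis using False by simp
        qed (use assms in auto)
      qed
      also have "\<dots> \<le> (b / g) * 2"
        unfolding sum_distrib_left[symmetric] using assms sum_inverse_squares_le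
        by (intro mult_left_mono) auto
      finally show "S / 2 * x \<le> b / g" by simp
    qed (use S0 in simp)
    then show ?thesis by simp
  qed
qed

text \<open>The error integral \<open>K\<close> of \<open>covariance_bounds\<close>, defined without
  coprimality so that sums over m and m' can run over a full square.\<close>

definition cov_bound :: "real \<Rightarrow> nat \<Rightarrow> nat \<Rightarrow> nat \<Rightarrow> ennreal" where
  "cov_bound b g m m' = (\<integral>\<^sup>+t. ennreal (8 * (b / max b (real g * (real m)\<^sup>2 * \<bar>t\<bar>)) * (b / max b (real g * (real m')\<^sup>2 * \<bar>t\<bar>))
     + 2 * min (b / max b (real g * (real m)\<^sup>2 * \<bar>t\<bar>) / m) (b / max b (real g * (real m')\<^sup>2 * \<bar>t\<bar>) / m'))
     * indicator {-1..1} t \<partial>lborel)"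

text \<open>The minimum is at most the quotient belonging to the larger index. A given m is the
  larger index for exactly m values of m', which cancels the division by m.\<close>

lemma sum_min_div_le:
  fixes k :: "nat \<Rightarrow> real"
  assumes "\<And>i. 0 \<le> k i"
  shows "(\<Sum>m=1..N. \<Sum>m'=1..N. min (k m / m) (k m' / m')) \<le> 2 * (\<Sum>m=1..N. k m)"
proof -
  have "min (k m / m) (k m' / m') \<le> (if m' \<le> m then k m / m else 0) + (if m \<le> m' then k m' / m' else 0)" for m m'
    using assms[of m] assms[of m'] by (auto simp: min_le_iff_disj)
  then have "(\<Sum>m=1..N. \<Sum>m'=1..N. min (k m / m) (k m' / m'))
    \<le> (\<Sum>m=1..N. \<Sum>m'=1..N. (if m' \<le> m then k m / m else 0) + (if m \<le> m' then k m' / m' else 0))"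
    by (intro sum_mono)
  also have "\<dots> = (\<Sum>m=1..N. \<Sum>m'=1..N. if m' \<le> m then k m / m else 0)
      + (\<Sum>m=1..N. \<Sum>m'=1..N. if m \<le> m' then k m' / m' else 0)"
    by (simp add: sum.distrib)
  also have "(\<Sum>m=1..N. \<Sum>m'=1..N. if m \<le> m' then k m' / m' else 0)
      = (\<Sum>m=1..N. \<Sum>m'=1..N. if m' \<le> m then k m / m else 0)"
    by (subst sum.swap) simp
  also have "(\<Sum>m=1..N. \<Sum>m'=1..N. if m' \<le> m then k m / m else 0) = (\<Sum>m=1..N. k m)"
  proof (rule sum.cong)
    fix m assume "m \<in> {1..N}"
    then have "{m'\<in>{1..N}. m' \<le> m} = {1..m}" by auto
    then show "(\<Sum>m'=1..N. if m' \<le> m then k m / m else 0) = k m"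
      using \<open>m \<in> {1..N}\<close> by (subst sum.inter_filter[symmetric]) auto
  qed simp
  finally show ?thesis by simp
qed

text \<open>Under the integral sign the products sum to \<open>8 S^2\<close> and the minima to at
  most \<open>4 S\<close>, where S is the sum of the cutoffs. With \<open>sum_cutoff_bounds\<close>
  this gives \<open>136 = 8 * 16 + 4 * 2\<close>; the factor 2 of
  \<open>nn_integral_inverse_max_le\<close> doubles it to 272.\<close>

lemma sum_cov_bound_le:
  assumes b: "0 < b" "b \<le> 1" and g: "g > 0" and N: "N \<ge> 1"
  shows "(\<Sum>m=1..N. \<Sum>m'=1..N. cov_bound b g m m') \<le> ennreal (272 * (b / g) * (1 + ln ((real N)\<^sup>2 * g / b)))"
proof -
  define k where "k i t = b / max b (real g * (real i)\<^sup>2 * \<bar>t\<bar>)" for i :: nat and t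
  have [measurable]: "k i \<in> borel_measurable borel" for i unfolding k_def by measurable
  have k0: "0 \<le> k i t" for i t using b by (simp add: k_def le_max_iff_disj)
  let ?\<tau> = "b / real g" let ?\<delta> = "b / real g / (real N)\<^sup>2"
  have \<delta>: "0 < ?\<delta>" "?\<delta> \<le> 1"
  proof -
    show "0 < ?\<delta>" using b g N by simp
    have "b \<le> 1 * 1" using b by simp
    also have "1 * 1 \<le> real g * (real N)\<^sup>2" using g N by (intro mult_mono) auto
    finally show "?\<delta> \<le> 1" using g N by (simp add: field_simps)
  qed
  have "(\<Sum>m=1..N. \<Sum>m'=1..N. cov_bound b g m m')
     = (\<integral>\<^sup>+t. (\<Sum>m=1..N. \<Sum>m'=1..N. ennreal (8 * k m t * k m' t + 2 * min (k m t / m) (k m' t / m')) * indicator {-1..1} t) \<partial>lborel)"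
    unfolding cov_bound_def k_def[symmetric]
    by (subst nn_integral_sum, measurable, intro sum.cong refl nn_integral_sum[symmetric], measurable)
  also have "\<dots> \<le> (\<integral>\<^sup>+t. ennreal (136 * ?\<tau>) * (ennreal (1 / max ?\<delta> \<bar>t\<bar>) * indicator {-1..1} t) \<partial>lborel)"
  proof (rule nn_integral_mono)
    fix t :: real
    let ?S = "\<Sum>m=1..N. k m t"
    have "(\<Sum>m=1..N. \<Sum>m'=1..N. ennreal (8 * k m t * k m' t + 2 * min (k m t / m) (k m' t / m')) * indicator {-1..1} t)
      = ennreal (\<Sum>m=1..N. \<Sum>m'=1..N. 8 * k m t * k m' t + 2 * min (k m t / m) (k m' t / m')) * indicator {-1..1} t"
    proof -
      have nn: "0 \<le> 8 * k m t * k m' t + 2 * min (k m t / m) (k m' t / m')" for m m'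
        using k0 by (intro add_nonneg_nonneg mult_nonneg_nonneg) auto
      show ?thesis
        by (simp only: sum_distrib_right[symmetric] sum_ennreal nn sum_nonneg)
    qed
    also have "\<dots> \<le> ennreal (136 * ?\<tau> * (1 / max ?\<delta> \<bar>t\<bar>)) * indicator {-1..1} t"
    proof (intro mult_right_mono ennreal_leI)
      have cutoff: "?S\<^sup>2 \<le> 16 * (?\<tau> * (1 / max ?\<delta> \<bar>t\<bar>))" "?S \<le> 2 * (?\<tau> * (1 / max ?\<delta> \<bar>t\<bar>))"
        unfolding k_def using b g N by (intro sum_cutoff_bounds; simp)+
      have square: "?S\<^sup>2 = (\<Sum>m=1..N. \<Sum>m'=1..N. k m t * k m' t)"
        unfolding power2_eq_square by (rule sum_product)
      have "(\<Sum>m=1..N. \<Sum>m'=1..N. 8 * k m t * k m' t + 2 * min (k m t / m) (k m' t / m'))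
         = 8 * ?S\<^sup>2 + 2 * (\<Sum>m=1..N. \<Sum>m'=1..N. min (k m t / m) (k m' t / m'))"
        unfolding square by (simp add: sum.distrib sum_distrib_left mult.assoc)
      also have "\<dots> \<le> 8 * ?S\<^sup>2 + 2 * (2 * ?S)"
        using sum_min_div_le[of "\<lambda>m. k m t" N] k0 by simp
      also have "\<dots> \<le> 136 * (?\<tau> * (1 / max ?\<delta> \<bar>t\<bar>))"
      proof -
        have "8 * v + 2 * (2 * s) \<le> 136 * j" if "v \<le> 16 * j" "s \<le> 2 * j" for v s j :: real
          using that by linarith
        from this[OF cutoff] show ?thesis .
      qed
      finally show "(\<Sum>m=1..N. \<Sum>m'=1..N. 8 * k m t * k m' t + 2 * min (k m t / m) (k m' t / m'))
         \<le> 136 * ?\<tau> * (1 / max ?\<delta> \<bar>t\<bar>)" by (simp only: mult.assoc)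
    qed simp
    also have "\<dots> = ennreal (136 * ?\<tau>) * (ennreal (1 / max ?\<delta> \<bar>t\<bar>) * indicator {-1..1} t)"
      unfolding mult.assoc[symmetric]
      using b by (subst ennreal_mult) (auto simp: le_max_iff_disj)
    finally show "(\<Sum>m=1..N. \<Sum>m'=1..N. ennreal (8 * k m t * k m' t + 2 * min (k m t / m) (k m' t / m')) * indicator {-1..1} t)
      \<le> ennreal (136 * ?\<tau>) * (ennreal (1 / max ?\<delta> \<bar>t\<bar>) * indicator {-1..1} t)" .
  qed
  also have "\<dots> = ennreal (136 * ?\<tau>) * (\<integral>\<^sup>+t. ennreal (1 / max ?\<delta> \<bar>t\<bar>) * indicator {-1..1} t \<partial>lborel)"
    by (rule nn_integral_cmult) measurable
  also have "\<dots> \<le> ennreal (136 * ?\<tau>) * ennreal (2 * (1 + ln (1 / ?\<delta>)))"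
    using nn_integral_inverse_max_le[OF \<delta>] by (intro mult_left_mono) auto
  also have "\<dots> = ennreal (272 * (b / g) * (1 + ln ((real N)\<^sup>2 * g / b)))"
  proof -
    have "1 \<le> 1 / d" if "0 < d" "d \<le> 1" for d :: real using that by simp
    from this[OF \<delta>] have "0 \<le> ln (1 / ?\<delta>)" by (rule ln_ge_zero)
    then show ?thesis
      using b by (subst ennreal_mult[symmetric]) (auto simp: field_simps)
  qed
  finally show ?thesis .
qed

text \<open>A pair is determined by its gcd and the two quotients, so the sum embeds into one over
  all triples up to N; the extra triples only add nonnegative terms. Summing 1/g costs the factor
  \<open>1 + ln N\<close>, and \<open>3 * ln N\<close> comes from
  \<open>N^2 * g \<le> N^3\<close>.\<close>

lemma sum_sum_cov_bound_le:
  assumes b: "0 < b" "b \<le> 1" and N: "N \<ge> 1"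
  shows "(\<Sum>q=1..N. \<Sum>q'=1..N. cov_bound b (gcd q q') (q div gcd q q') (q' div gcd q q'))
     \<le> ennreal (272 * b * (1 + ln N) * (1 + 3 * ln N + ln (1 / b)))"
proof -
  define \<phi> where "\<phi> = (\<lambda>(q, q'). (gcd q q', q div gcd q q', q' div gcd q q' :: nat))"
  let ?A = "{1..N} \<times> {1..N}"
  let ?f = "\<lambda>(g, m, m'). cov_bound b g m m'"
  have inj: "inj_on \<phi> ?A"
  proof (rule inj_onI)
    fix x y assume "\<phi> x = \<phi> y"
    moreover obtain q q' r r' where "x = (q, q')" "y = (r, r')" by (cases x, cases y)
    ultimately show "x = y"
      by (auto simp: \<phi>_def) (metis dvd_mult_div_cancel gcd_dvd1 gcd_dvd2)+
  qed
  have sub: "\<phi> ` ?A \<subseteq> {1..N} \<times> {1..N} \<times> {1..N}"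
  proof -
    have "gcd q q' \<in> {1..N} \<and> q div gcd q q' \<in> {1..N} \<and> q' div gcd q q' \<in> {1..N}"
      if "q \<in> {1..N}" "q' \<in> {1..N}" for q q'
    proof -
      have le: "gcd q q' \<le> q" "gcd q q' \<le> q'" "gcd q q' > 0" using that by (auto intro!: dvd_imp_le)
      then have "q div gcd q q' \<ge> 1" "q' div gcd q q' \<ge> 1"
        by (auto simp: Suc_le_eq div_greater_zero_iff)
      moreover have "q \<le> N" "q' \<le> N" using that by auto
      ultimately show ?thesis using le div_le_dividend[of q "gcd q q'"] div_le_dividend[of q' "gcd q q'"]
        by (simp only: atLeastAtMost_iff) (intro conjI TrueI; linarith)
    qed
    then show ?thesis by (auto simp: \<phi>_def)
  qed
  have "(\<Sum>q=1..N. \<Sum>q'=1..N. cov_bound b (gcd q q') (q div gcd q q') (q' div gcd q q'))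
      = (\<Sum>x\<in>?A. ?f (\<phi> x))"
    unfolding sum.cartesian_product by (intro sum.cong) (auto simp: \<phi>_def)
  also have "\<dots> = (\<Sum>y\<in>\<phi> ` ?A. ?f y)" using inj by (simp add: sum.reindex)
  also have "\<dots> \<le> (\<Sum>y\<in>{1..N} \<times> {1..N} \<times> {1..N}. ?f y)"
    using sub by (intro sum_mono2) auto
  also have "\<dots> = (\<Sum>g=1..N. \<Sum>m=1..N. \<Sum>m'=1..N. cov_bound b g m m')"
    by (simp add: sum.cartesian_product)
  also have "\<dots> \<le> (\<Sum>g=1..N. ennreal (272 * b * (1 + 3 * ln N + ln (1 / b)) * (1 / g)))"
  proof (rule sum_mono)
    fix g assume g: "g \<in> {1..N}"
    have "(\<Sum>m=1..N. \<Sum>m'=1..N. cov_bound b g m m') \<le> ennreal (272 * (b / g) * (1 + ln ((real N)\<^sup>2 * g / b)))"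
      using g N b by (intro sum_cov_bound_le) auto
    also have "\<dots> \<le> ennreal (272 * (b / g) * (1 + 3 * ln N + ln (1 / b)))"
    proof (intro ennreal_leI mult_left_mono)
      have "ln ((real N)\<^sup>2 * g / b) = 2 * ln N + ln g + ln (1 / b)"
        using g b N by (simp add: ln_mult ln_div ln_realpow)
      moreover have "ln g \<le> ln N" using g by simp
      ultimately show "1 + ln ((real N)\<^sup>2 * g / b) \<le> 1 + 3 * ln N + ln (1 / b)" by simp
    qed (use b in auto)
    finally show "(\<Sum>m=1..N. \<Sum>m'=1..N. cov_bound b g m m') \<le> ennreal (272 * b * (1 + 3 * ln N + ln (1 / b)) * (1 / g))"
      by (simp add: field_simps)
  qed
  also have "\<dots> = ennreal (272 * b * (1 + 3 * ln N + ln (1 / b)) * (\<Sum>g=1..N. 1 / g))"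
  proof -
    have "0 \<le> ln (1 / b)" "0 \<le> ln N" using b N by (auto intro!: ln_ge_zero simp: field_simps)
    then show ?thesis using b by (subst sum_ennreal) (auto simp: sum_distrib_left)
  qed
  also have "\<dots> \<le> ennreal (272 * b * (1 + ln N) * (1 + 3 * ln N + ln (1 / b)))"
  proof -
    have "0 \<le> ln (1 / b)" "0 \<le> ln N" using b N by (auto intro!: ln_ge_zero simp: field_simps)
    \<comment> \<open>The sequence \<open>harm n - ln n\<close> decreases from its value 1 at
      \<open>n = 1\<close>.\<close>
    moreover have "(\<Sum>g=1..N. 1 / real g) \<le> 1 + ln N"
      using euler_mascheroni_sequence_decreasing[of 1 N] N by (simp add: harm_def inverse_eq_divide)
    ultimately have "272 * b * (1 + 3 * ln N + ln (1 / b)) * (\<Sum>g=1..N. 1 / g)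
       \<le> 272 * b * (1 + 3 * ln N + ln (1 / b)) * (1 + ln N)"
      using b by (intro mult_left_mono) auto
    then show ?thesis by (intro ennreal_leI) (simp only: ac_simps)
  qed
  finally show ?thesis .
qed

section \<open>The variance\<close>

definition hit_set :: "real \<Rightarrow> real \<Rightarrow> nat \<Rightarrow> (real \<times> real) set" where
  "hit_set b c q = {x. (dist_nearest_int (real q * fst x), dist_nearest_int (real q * snd x)) \<in> hyp_star b c (real q)}"

lemma sets_hit_set [measurable]: "hit_set b c q \<in> sets borel"
proof -
  have "(\<lambda>x::real\<times>real. (dist_nearest_int (real q * fst x), dist_nearest_int (real q * snd x))) \<in> borel \<rightarrow>\<^sub>M borel"
    unfolding borel_prod[symmetric] by measurable
  from measurable_sets[OF this sets_hyp_star] show ?thesis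
    by (simp add: hit_set_def vimage_def)
qed

lemma sets_unit_square [measurable]: "{0..<1} \<times> {0..<1} \<in> sets (borel :: (real \<times> real) measure)"
  unfolding borel_prod[symmetric] by measurable

lemma emeasure_unit_square: "emeasure lborel ({0..<1} \<times> {0..<1} :: (real \<times> real) set) = 1"
  unfolding lborel_prod[symmetric] by (subst lborel.emeasure_pair_measure_Times) auto

text \<open>\<open>nn_integral_dist_nearest_int\<close> is applied in each coordinate, and
  \<open>c < 1/2\<close> keeps the star inside the square carrying the law of the two distances.
  Centring an event at this area is thus centring it at its mean.\<close>

lemma emeasure_hit_set:
  assumes "q > 0" "0 < c" "c < 1/2"
  shows "emeasure lborel (hit_set b c q \<inter> {0..<1} \<times> {0..<1}) = emeasure lborel (hyp_star b c (real q))"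
proof -
  let ?A = "hyp_star b c (real q)"
  have A [measurable]: "?A \<in> sets (lborel \<Otimes>\<^sub>M lborel)" unfolding lborel_prod sets_lborel by (rule sets_hyp_star)
  define G where "G s = (\<integral>\<^sup>+v. indicator ?A (s, \<bar>v\<bar>) * indicator {-1/2..1/2} v \<partial>lborel)" for s :: real
  have G [measurable]: "G \<in> borel_measurable borel"
  proof -
    have "(\<lambda>p::real\<times>real. indicator ?A (fst p, \<bar>snd p\<bar>) * indicator {-1/2..1/2} (snd p) :: ennreal) \<in> borel_measurable (lborel \<Otimes>\<^sub>M lborel)"
      by measurable
    from lborel.borel_measurable_nn_integral_fst[OF this] show ?thesis by (simp add: G_def[abs_def])
  qed
  have H: "hit_set b c q \<inter> {0..<1} \<times> {0..<1} \<in> sets (lborel \<Otimes>\<^sub>M lborel)"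
    unfolding lborel_prod sets_lborel by measurable
  have "emeasure lborel (hit_set b c q \<inter> {0..<1} \<times> {0..<1})
      = (\<integral>\<^sup>+x. \<integral>\<^sup>+y. indicator (hit_set b c q \<inter> {0..<1} \<times> {0..<1}) (x, y) \<partial>lborel \<partial>lborel)"
    unfolding lborel_prod[symmetric] by (rule lborel.emeasure_pair_measure[OF H])
  also have "\<dots> = (\<integral>\<^sup>+x. G (dist_nearest_int (real q * x)) * indicator {0..<1} x \<partial>lborel)"
  proof (rule nn_integral_cong)
    fix x :: real
    let ?s = "dist_nearest_int (real q * x)"
    have "Pair ?s -` ?A \<in> sets lborel" by (rule sets_Pair1[OF A])
    then have m: "indicator (Pair ?s -` ?A) \<in> (borel_measurable borel :: (real \<Rightarrow> ennreal) set)" by simp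
    have "(\<integral>\<^sup>+y. indicator (hit_set b c q \<inter> {0..<1} \<times> {0..<1}) (x, y) \<partial>lborel)
       = (\<integral>\<^sup>+y. (indicator (Pair ?s -` ?A) (dist_nearest_int (real q * y)) * indicator {0..<1} y) * indicator {0..<1} x \<partial>lborel)"
      by (intro nn_integral_cong) (auto simp: hit_set_def indicator_def)
    also have "\<dots> = (\<integral>\<^sup>+y. indicator (Pair ?s -` ?A) (dist_nearest_int (real q * y)) * indicator {0..<1} y \<partial>lborel) * indicator {0..<1} x"
      by (intro nn_integral_multc borel_measurable_times measurable_compose[OF _ m]) measurable
    also have "(\<integral>\<^sup>+y. indicator (Pair ?s -` ?A) (dist_nearest_int (real q * y)) * indicator {0..<1} y \<partial>lborel) = G ?s"
      unfolding nn_integral_dist_nearest_int[OF m assms(1)] G_def by (simp add: indicator_def)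
    finally show "(\<integral>\<^sup>+y. indicator (hit_set b c q \<inter> {0..<1} \<times> {0..<1}) (x, y) \<partial>lborel) = G ?s * indicator {0..<1} x" .
  qed
  also have "\<dots> = (\<integral>\<^sup>+u. G \<bar>u\<bar> * indicator {-1/2..1/2} u \<partial>lborel)"
    by (rule nn_integral_dist_nearest_int[OF G assms(1)])
  also have "\<dots> = (\<integral>\<^sup>+u. \<integral>\<^sup>+v. indicator ?A (u, v) \<partial>lborel \<partial>lborel)"
  proof (rule nn_integral_cong)
    fix u :: real
    have "G \<bar>u\<bar> * indicator {-1/2..1/2} u
      = (\<integral>\<^sup>+v. indicator ?A (\<bar>u\<bar>, \<bar>v\<bar>) * indicator {-1/2..1/2} v * indicator {-1/2..1/2} u \<partial>lborel)"
      unfolding G_def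
    proof (rule nn_integral_multc[symmetric])
      show "(\<lambda>v. indicator ?A (\<bar>u\<bar>, \<bar>v\<bar>) * indicator {-1/2..1/2} v :: ennreal) \<in> borel_measurable lborel"
        by measurable
    qed
    also have "\<dots> = (\<integral>\<^sup>+v. indicator ?A (u, v) \<partial>lborel)"
      using assms by (intro nn_integral_cong) (auto simp: hyp_star_def indicator_def abs_mult)
    finally show "G \<bar>u\<bar> * indicator {-1/2..1/2} u = (\<integral>\<^sup>+v. indicator ?A (u, v) \<partial>lborel)" .
  qed
  also have "\<dots> = emeasure lborel ?A"
    unfolding lborel_prod[symmetric] by (rule lborel.emeasure_pair_measure[OF A, symmetric])
  finally show ?thesis .
qed

lemma emeasure_hyp_star_finite:
  assumes "0 < c"
  shows "emeasure lborel (hyp_star b c y) < \<infinity>"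
proof -
  have "emeasure lborel (hyp_star b c y) \<le> emeasure lborel (cbox (-c, -c) (c, c))"
    by (intro emeasure_mono) (auto simp: hyp_star_def cbox_Pair_eq abs_le_iff)
  also have "\<dots> < \<infinity>" by (rule emeasure_lborel_cbox_finite)
  finally show ?thesis .
qed

lemma emeasure_hit_set_Int_bounds:
  assumes b: "b > 0" and c: "0 < c" "c < 1/2" and pos: "q > 0" "q' > 0"
  defines "E \<equiv> emeasure lborel (hit_set b c q \<inter> hit_set b c q' \<inter> {0..<1} \<times> {0..<1})"
    and "W \<equiv> \<lambda>q. emeasure lborel (hyp_star b c (real q))"
    and "K \<equiv> cov_bound b (gcd q q') (q div gcd q q') (q' div gcd q q')"
  shows "E \<le> W q * W q' + K" and "W q * W q' \<le> E + K"
proof -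
  define g where g: "g = gcd q q'"
  define m m' where gm: "m = q div g" "m' = q' div g"
  have q: "q = g * m" "q' = g * m'" by (auto simp: g gm)
  have p: "g > 0" "m > 0" "m' > 0" using pos q by (auto intro!: Nat.gr0I)
  have cop: "coprime m m'" using pos unfolding g gm by (intro div_gcd_coprime) auto
  have E: "E = (\<integral>\<^sup>+x. indicator (hyp_star b c (real q)) (dist_nearest_int (real q * fst x), dist_nearest_int (real q * snd x))
     * indicator (hyp_star b c (real q')) (dist_nearest_int (real q' * fst x), dist_nearest_int (real q' * snd x))
     * indicator ({0..<1} \<times> {0..<1}) x \<partial>lborel)"
  proof -
    have "E = (\<integral>\<^sup>+x. indicator (hit_set b c q \<inter> hit_set b c q' \<inter> {0..<1} \<times> {0..<1}) x \<partial>lborel)"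
      unfolding E_def by (rule nn_integral_indicator[symmetric]) measurable
    then show ?thesis by (simp only: hit_set_def indicator_inter_arith) (simp add: indicator_def)
  qed
  note cb = covariance_bounds[OF b c p cop, folded q]
  show "E \<le> W q * W q' + K" "W q * W q' \<le> E + K"
    unfolding E W_def K_def cov_bound_def g[symmetric] gm[symmetric] by (rule cb)+
qed

text \<open>With every event centred at its mean, the second moment is a double sum of weighted
  covariances. The two-sided bounds control their absolute values, so the weights may have any
  sign.\<close>

lemma variance_bound:
  fixes w :: "nat \<Rightarrow> real"
  assumes b: "0 < b" "b \<le> 1" and c: "0 < c" "c < 1/2" and N: "N \<ge> 1"
    and w: "\<And>q. \<bar>w q\<bar> \<le> H"
  defines "V \<equiv> \<lambda>x. (\<Sum>q=1..N. w q * (indicator (hit_set b c q) x - measure lborel (hyp_star b c (real q))))\<^sup>2"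
  shows "set_integrable lborel ({0..<1} \<times> {0..<1}) V"
    and "(LINT x:{0..<1} \<times> {0..<1}|lborel. V x) \<le> H\<^sup>2 * (272 * b * (1 + ln N) * (1 + 3 * ln N + ln (1 / b)))"
proof -
  define U where "U = ({0..<1} \<times> {0..<1} :: (real \<times> real) set)"
  have U [measurable]: "U \<in> sets borel" unfolding U_def by measurable
  have eU: "emeasure lborel U = 1" unfolding U_def by (rule emeasure_unit_square)
  define W where "W q = measure lborel (hyp_star b c (real q))" for q :: nat
  define C where "C q q' = measure lborel (hit_set b c q \<inter> hit_set b c q' \<inter> U) - W q * W q'" for q q'
  define D where "D q x = (indicator (hit_set b c q) x - W q :: real)" for q x
  have fin: "emeasure lborel (A \<inter> U) < \<infinity>" if "A \<in> sets borel" for A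
  proof -
    have "emeasure lborel (A \<inter> U) \<le> emeasure lborel U" by (intro emeasure_mono) auto
    then show ?thesis by (simp add: eU le_less_trans)
  qed
  have ind: "has_bochner_integral lborel (indicator (A \<inter> U)) (measure lborel (A \<inter> U))" if "A \<in> sets borel" for A
    using fin[OF that] that by (intro has_bochner_integral_real_indicator) auto
  have Wm: "measure lborel (hit_set b c q \<inter> U) = W q" if "q > 0" for q
    unfolding measure_def W_def U_def by (simp add: emeasure_hit_set[OF that c])
  \<comment> \<open>Expanding the product and inserting the exact means of the single events leaves
    the covariance.\<close>
  have DD: "has_bochner_integral lborel (\<lambda>x. indicator U x *\<^sub>R (D q x * D q' x)) (C q q')" if "q > 0" "q' > 0" for q q'
  proof -
    have "has_bochner_integral lborel (\<lambda>x. indicator (hit_set b c q \<inter> hit_set b c q' \<inter> U) x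
        - W q' * indicator (hit_set b c q \<inter> U) x - W q * indicator (hit_set b c q' \<inter> U) x + W q * W q' * indicator (UNIV \<inter> U) x)
      (measure lborel (hit_set b c q \<inter> hit_set b c q' \<inter> U) - W q' * measure lborel (hit_set b c q \<inter> U)
         - W q * measure lborel (hit_set b c q' \<inter> U) + W q * W q' * measure lborel (UNIV \<inter> U))"
      by (intro has_bochner_integral_add has_bochner_integral_diff has_bochner_integral_mult_right ind) measurable
    moreover have "(\<lambda>x. indicator (hit_set b c q \<inter> hit_set b c q' \<inter> U) x
        - W q' * indicator (hit_set b c q \<inter> U) x - W q * indicator (hit_set b c q' \<inter> U) x + W q * W q' * indicator (UNIV \<inter> U) x)
      = (\<lambda>x. indicator U x *\<^sub>R (D q x * D q' x))"
      by (auto simp: D_def indicator_def algebra_simps)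
    moreover have "measure lborel U = 1" by (simp add: measure_def eU)
    ultimately show ?thesis using that by (simp add: Wm C_def mult.commute)
  qed
  have "has_bochner_integral lborel (\<lambda>x. \<Sum>q=1..N. \<Sum>q'=1..N. w q * w q' * (indicator U x *\<^sub>R (D q x * D q' x)))
    (\<Sum>q=1..N. \<Sum>q'=1..N. w q * w q' * C q q')"
    by (intro has_bochner_integral_sum has_bochner_integral_mult_right DD) auto
  moreover have "(\<Sum>q=1..N. \<Sum>q'=1..N. w q * w q' * (indicator U x *\<^sub>R (D q x * D q' x))) = indicator U x *\<^sub>R V x" for x
    unfolding V_def D_def[symmetric] W_def[symmetric] power2_eq_square sum_product
    by (simp add: sum_distrib_left ac_simps)
  ultimately have V: "has_bochner_integral lborel (\<lambda>x. indicator U x *\<^sub>R V x) (\<Sum>q=1..N. \<Sum>q'=1..N. w q * w q' * C q q')"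
    by simp
  show "set_integrable lborel ({0..<1} \<times> {0..<1}) V"
    using V unfolding set_integrable_def U_def by (rule integrable.intros)
  have H: "0 \<le> H" using w[of 0] by linarith
  \<comment> \<open>\<open>cov_bound\<close> takes values in \<open>ennreal\<close>. If it is
    infinite there is nothing to show; otherwise the two one-sided bounds combine.\<close>
  have C: "ennreal \<bar>C q q'\<bar> \<le> cov_bound b (gcd q q') (q div gcd q q') (q' div gcd q q')" if "q > 0" "q' > 0" for q q'
  proof (cases "cov_bound b (gcd q q') (q div gcd q q') (q' div gcd q q')")
    case (real k)
    define e where "e = measure lborel (hit_set b c q \<inter> hit_set b c q' \<inter> U)"
    have e: "emeasure lborel (hit_set b c q \<inter> hit_set b c q' \<inter> {0..<1} \<times> {0..<1}) = ennreal e"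
      unfolding e_def U_def[symmetric] using fin[of "hit_set b c q \<inter> hit_set b c q'"] by (intro emeasure_eq_ennreal_measure) auto
    have We: "emeasure lborel (hyp_star b c (real q)) = ennreal (W q)" for q
      unfolding W_def using emeasure_hyp_star_finite[OF c(1), of b "real q"] by (intro emeasure_eq_ennreal_measure) auto
    have nn: "0 \<le> e" "0 \<le> W q" for q by (simp_all add: e_def W_def)
    have "ennreal e \<le> ennreal (W q * W q' + k)" "ennreal (W q * W q') \<le> ennreal (e + k)"
      using emeasure_hit_set_Int_bounds[OF b(1) c that] real nn
      unfolding e We by (simp_all add: ennreal_mult)
    then have "e \<le> W q * W q' + k" "W q * W q' \<le> e + k"
      using nn real by (simp_all del: ennreal_plus)
    then have "\<bar>C q q'\<bar> \<le> k" by (simp add: C_def e_def)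
    then show ?thesis using real by (simp add: ennreal_leI)
  qed simp
  have "ennreal (\<Sum>q=1..N. \<Sum>q'=1..N. \<bar>C q q'\<bar>) = (\<Sum>q=1..N. \<Sum>q'=1..N. ennreal \<bar>C q q'\<bar>)"
    by (simp only: sum_ennreal sum_nonneg abs_ge_zero)
  also have "\<dots> \<le> (\<Sum>q=1..N. \<Sum>q'=1..N. cov_bound b (gcd q q') (q div gcd q q') (q' div gcd q q'))"
    by (intro sum_mono C) auto
  also have "\<dots> \<le> ennreal (272 * b * (1 + ln N) * (1 + 3 * ln N + ln (1 / b)))"
    by (rule sum_sum_cov_bound_le[OF b N])
  finally have "ennreal (\<Sum>q=1..N. \<Sum>q'=1..N. \<bar>C q q'\<bar>) \<le> ennreal (272 * b * (1 + ln N) * (1 + 3 * ln N + ln (1 / b)))" .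
  moreover have "0 \<le> 272 * b * (1 + ln N) * (1 + 3 * ln N + ln (1 / b))"
  proof -
    have "0 \<le> ln (1 / b)" "0 \<le> ln N" using b N by (auto intro!: ln_ge_zero simp: field_simps)
    then show ?thesis using b by simp
  qed
  ultimately have sumC: "(\<Sum>q=1..N. \<Sum>q'=1..N. \<bar>C q q'\<bar>) \<le> 272 * b * (1 + ln N) * (1 + 3 * ln N + ln (1 / b))"
    by (simp add: ennreal_le_iff)
  have "(LINT x:{0..<1} \<times> {0..<1}|lborel. V x) = (\<Sum>q=1..N. \<Sum>q'=1..N. w q * w q' * C q q')"
    using V unfolding set_lebesgue_integral_def U_def by (rule has_bochner_integral_integral_eq)
  also have "\<dots> \<le> (\<Sum>q=1..N. \<Sum>q'=1..N. H\<^sup>2 * \<bar>C q q'\<bar>)"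
  proof (intro sum_mono)
    fix q q'
    have "\<bar>w q * w q'\<bar> \<le> H\<^sup>2"
      unfolding abs_mult power2_eq_square using w H by (intro mult_mono) auto
    then have "\<bar>w q * w q' * C q q'\<bar> \<le> H\<^sup>2 * \<bar>C q q'\<bar>"
      unfolding abs_mult[of "w q * w q'"] by (intro mult_right_mono) auto
    then show "w q * w q' * C q q' \<le> H\<^sup>2 * \<bar>C q q'\<bar>" by linarith
  qed
  also have "\<dots> = H\<^sup>2 * (\<Sum>q=1..N. \<Sum>q'=1..N. \<bar>C q q'\<bar>)" by (simp add: sum_distrib_left)
  also have "\<dots> \<le> H\<^sup>2 * (272 * b * (1 + ln N) * (1 + 3 * ln N + ln (1 / b)))"
    using sumC by (intro mult_left_mono) auto
  finally show "(LINT x:{0..<1} \<times> {0..<1}|lborel. V x) \<le> H\<^sup>2 * (272 * b * (1 + ln N) * (1 + 3 * ln N + ln (1 / b)))" .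
qed

section \<open>The mean\<close>

definition star_area :: "real \<Rightarrow> real \<Rightarrow> real \<Rightarrow> real" where
  "star_area b c y = measure lborel (hyp_star b c y)"

lemma fmeasurable_hyp_star:
  assumes "0 < c"
  shows "hyp_star b c y \<in> fmeasurable lborel"
  using emeasure_hyp_star_finite[OF assms] sets_hyp_star by (auto simp: fmeasurable_def)

lemma star_area_nonneg: "0 \<le> star_area b c y"
  by (simp add: star_area_def)

lemma star_area_antimono:
  assumes "0 < c" "y \<le> y'"
  shows "star_area b c y' \<le> star_area b c y"
  unfolding star_area_def
proof (rule measure_mono_fmeasurable)
  show "hyp_star b c y' \<subseteq> hyp_star b c y"
  proof
    fix p assume p: "p \<in> hyp_star b c y'"
    obtain u v where uv: "p = (u, v)" by (cases p)
    have "\<bar>u * v\<bar> * y \<le> \<bar>u * v\<bar> * y'" using assms(2) by (intro mult_left_mono) auto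
    then show "p \<in> hyp_star b c y" using p by (auto simp: hyp_star_def uv)
  qed
qed (auto simp: sets_hyp_star fmeasurable_hyp_star assms)

lemma borel_measurable_star_area:
  assumes "0 < c"
  shows "star_area b c \<in> borel_measurable borel"
proof -
  have "(\<lambda>y. - star_area b c y) \<in> borel_measurable borel"
    using star_area_antimono[OF assms] by (intro borel_measurable_mono monoI) simp
  from borel_measurable_uminus[OF this] show ?thesis by simp
qed

text \<open>Height 1 gives the largest area for \<open>y \<ge> 1\<close>, and the error in the mean
  is a multiple of it. The half-lengths of the sections are at most \<open>b / max b |u|\<close>,
  whose integral is logarithmic.\<close>

lemma star_area_one_le:
  assumes b: "0 < b" "b \<le> 1" and c: "0 < c" "c < 1/2"
  shows "star_area b c 1 \<le> 4 * b * (1 + ln (1 / b))"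
proof -
  have L: "0 \<le> ln (1 / b)" using b by (auto intro!: ln_ge_zero simp: field_simps)
  have le: "hyp_cut b c 1 \<bar>u\<bar> \<le> b * (1 / max b \<bar>u\<bar>)" for u
  proof -
    have "b \<le> b / c" using b c by (simp add: field_simps)
    then have "max b \<bar>u\<bar> \<le> max (b / c) (1 * \<bar>u\<bar>)" by (intro max.mono) auto
    then show ?thesis using b c unfolding hyp_cut_def times_divide_eq_right mult_1_right
      by (intro divide_left_mono mult_pos_pos) (auto simp: less_max_iff_disj)
  qed
  have "emeasure lborel (hyp_star b c 1) = (\<integral>\<^sup>+u. ennreal (2 * hyp_cut b c 1 \<bar>u\<bar>) * indicator {-c..c} u \<partial>lborel)"
    using b c by (intro emeasure_hyp_star) auto
  also have "\<dots> \<le> (\<integral>\<^sup>+u. ennreal (2 * b) * (ennreal (1 / max b \<bar>u\<bar>) * indicator {-1..1} u) \<partial>lborel)"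
  proof (rule nn_integral_mono)
    fix u :: real
    have "ennreal (2 * hyp_cut b c 1 \<bar>u\<bar>) * indicator {-c..c} u \<le> ennreal (2 * (b * (1 / max b \<bar>u\<bar>))) * indicator {-1..1} u"
      using c le[of u] hyp_cut_bounds(1)[OF b(1) c(1)] by (intro mult_mono ennreal_leI) (auto simp: indicator_def)
    also have "\<dots> = ennreal (2 * b) * (ennreal (1 / max b \<bar>u\<bar>) * indicator {-1..1} u)"
      using b unfolding mult.assoc[symmetric]
      by (subst ennreal_mult[symmetric]) (auto simp: le_max_iff_disj)
    finally show "ennreal (2 * hyp_cut b c 1 \<bar>u\<bar>) * indicator {-c..c} u
       \<le> ennreal (2 * b) * (ennreal (1 / max b \<bar>u\<bar>) * indicator {-1..1} u)" .
  qed
  also have "\<dots> = ennreal (2 * b) * (\<integral>\<^sup>+u. ennreal (1 / max b \<bar>u\<bar>) * indicator {-1..1} u \<partial>lborel)"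
    by (rule nn_integral_cmult) measurable
  also have "\<dots> \<le> ennreal (2 * b) * ennreal (2 * (1 + ln (1 / b)))"
    using nn_integral_inverse_max_le[OF b] by (intro mult_left_mono) auto
  also have "\<dots> = ennreal (4 * b * (1 + ln (1 / b)))"
    using b L by (subst ennreal_mult[symmetric]) (auto simp: algebra_simps)
  finally have "emeasure lborel (hyp_star b c 1) \<le> ennreal (4 * b * (1 + ln (1 / b)))" .
  then show ?thesis unfolding star_area_def measure_def
    using b L by (intro enn2real_leI) auto
qed

lemma set_integral_near_const:
  fixes F :: "real \<Rightarrow> real"
  assumes "set_integrable lborel {a..<b} F" "a \<le> b" "\<And>y. y \<in> {a..<b} \<Longrightarrow> \<bar>F y - v\<bar> \<le> B"
  shows "\<bar>(LINT y:{a..<b}|lborel. F y) - v * (b - a)\<bar> \<le> B * (b - a)"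
proof -
  have const: "set_integrable lborel {a..<b} (\<lambda>_. k)" "(LINT y:{a..<b}|lborel. k) = k * (b - a)" for k :: real
  proof -
    show "set_integrable lborel {a..<b} (\<lambda>_. k)"
      using assms(2) unfolding set_integrable_def by (intro integrable_scaleR_left integrable_real_indicator) auto
    show "(LINT y:{a..<b}|lborel. k) = k * (b - a)"
      using assms(2) by (subst set_integral_const) auto
  qed
  have "(LINT y:{a..<b}|lborel. F y) \<le> (LINT y:{a..<b}|lborel. v + B)"
    using assms(3) by (intro set_integral_mono assms const) (auto simp: abs_le_iff algebra_simps)
  moreover have "(LINT y:{a..<b}|lborel. v - B) \<le> (LINT y:{a..<b}|lborel. F y)"
    using assms(3) by (intro set_integral_mono assms const) (auto simp: abs_le_iff algebra_simps)
  ultimately show ?thesis unfolding const by (simp add: abs_le_iff algebra_simps)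
qed

lemma set_integrable_weighted_area:
  fixes h :: "real \<Rightarrow> real"
  assumes "0 < c" "h \<in> borel_measurable borel" "\<And>s. \<bar>h s\<bar> \<le> H"
  shows "set_integrable lborel {x..<z} (\<lambda>y. h (y / T) * star_area b c y)"
  unfolding set_integrable_def
proof (rule integrableI_bounded_set_indicator)
  show "(\<lambda>y. h (y / T) * star_area b c y) \<in> borel_measurable lborel"
    using assms(2) borel_measurable_star_area[OF assms(1), of b] by measurable
  show "emeasure lborel {x..<z} < \<infinity>" by (cases "x \<le> z") auto
  have "\<bar>h (y / T) * star_area b c y\<bar> \<le> H * star_area b c x" if "y \<in> {x..<z}" for y
    unfolding abs_mult using that assms star_area_antimono[OF assms(1), of x y b] star_area_nonneg
    by (intro mult_mono) (auto intro: order_trans[OF abs_ge_zero])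
  then show "AE y in lborel. y \<in> {x..<z} \<longrightarrow> norm (h (y / T) * star_area b c y) \<le> H * star_area b c x"
    by auto
qed simp

text \<open>On a unit interval the weight varies by at most \<open>L / T\<close>; over fewer than T
  intervals this adds up to L times the area at 1. The variation of the decreasing area telescopes
  and costs H times that area. The overhang \<open>[T, N + 1)\<close> has length at most 1 and costs
  another H.\<close>

lemma sum_integral_weighted_area:
  fixes h :: "real \<Rightarrow> real" and b c T L H :: real
  assumes c: "0 < c" and T: "T > 1" and N: "real N < T" "T \<le> real N + 1"
    and L: "L-lipschitz_on UNIV h" and H: "\<And>s. \<bar>h s\<bar> \<le> H"
  defines "F \<equiv> \<lambda>y. h (y / T) * star_area b c y"
  shows "\<bar>(\<Sum>q=1..N. F (real q)) - (LINT y:{1..<T}|lborel. F y)\<bar> \<le> (L + 2 * H) * star_area b c 1"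
proof -
  let ?W = "star_area b c"
  have H0: "0 \<le> H" using H[of 0] by linarith
  have L0: "0 \<le> L" using L by (rule lipschitz_on_nonneg)
  have hm: "h \<in> borel_measurable borel"
    using lipschitz_on_continuous_on[OF L] by (rule borel_measurable_continuous_onI)
  have int: "set_integrable lborel {x..<z} F" for x z
    unfolding F_def by (rule set_integrable_weighted_area[OF c hm H])
  define K where "K = L / T * ?W 1"
  have step: "\<bar>(LINT y:{x..<x+1}|lborel. F y) - F x\<bar> \<le> K + H * (?W x - ?W (x + 1))" if x: "x \<ge> 1" for x
  proof -
    have "\<bar>F y - F x\<bar> \<le> K + H * (?W x - ?W (x + 1))" if y: "y \<in> {x..<x+1}" for y
    proof -
      have "\<bar>h (y / T) - h (x / T)\<bar> \<le> L * \<bar>y / T - x / T\<bar>"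
        using lipschitz_onD[OF L] by (simp add: dist_real_def)
      also have "\<dots> \<le> L * (1 / T)"
        using y T L0 by (intro mult_left_mono) (auto simp flip: diff_divide_distrib simp: divide_right_mono)
      finally have 1: "\<bar>h (y / T) - h (x / T)\<bar> \<le> L / T" by simp
      \<comment> \<open>This separates the variation of the weight from that of the area; only the
        second part needs to telescope.\<close>
      have "F y - F x = (h (y / T) - h (x / T)) * ?W x - h (y / T) * (?W x - ?W y)"
        unfolding F_def by (simp add: algebra_simps)
      then have "\<bar>F y - F x\<bar> \<le> \<bar>h (y / T) - h (x / T)\<bar> * \<bar>?W x\<bar> + \<bar>h (y / T)\<bar> * \<bar>?W x - ?W y\<bar>"
        by (metis abs_mult abs_triangle_ineq4)
      also have "\<dots> \<le> K + H * (?W x - ?W (x + 1))"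
        unfolding K_def using 1 H star_area_antimono[OF c, of x y b] star_area_antimono[OF c, of y "x + 1" b]
          star_area_antimono[OF c, of 1 x b] x y star_area_nonneg[of b c] T L0 H0
        by (intro add_mono mult_mono) auto
      finally show ?thesis .
    qed
    from set_integral_near_const[of x "x + 1" F "F x", OF int _ this] show ?thesis by simp
  qed
  have main: "\<bar>(\<Sum>q=1..n. F (real q)) - (LINT y:{1..<real n + 1}|lborel. F y)\<bar>
      \<le> real n * K + H * (?W 1 - ?W (real n + 1))" for n
  proof (induction n)
    case 0
    then show ?case by (simp add: set_lebesgue_integral_def)
  next
    case (Suc n)
    have "{1..<real (Suc n) + 1} = {1..<real n + 1} \<union> {real (Suc n)..<real (Suc n) + 1}" by auto
    then have "(LINT y:{1..<real (Suc n) + 1}|lborel. F y)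
        = (LINT y:{1..<real n + 1}|lborel. F y) + (LINT y:{real (Suc n)..<real (Suc n) + 1}|lborel. F y)"
      by (simp only:) (rule set_integral_Un[OF _ int int], auto)
    moreover have "(\<Sum>q=1..Suc n. F (real q)) = (\<Sum>q=1..n. F (real q)) + F (real (Suc n))" by simp
    moreover note step[of "real (Suc n)"] Suc
    ultimately show ?case by (simp add: algebra_simps)
  qed
  have "{1..<real N + 1} = {1..<T} \<union> {T..<real N + 1}" using T N by auto
  then have "(LINT y:{1..<real N + 1}|lborel. F y) = (LINT y:{1..<T}|lborel. F y) + (LINT y:{T..<real N + 1}|lborel. F y)"
    by (simp only:) (rule set_integral_Un[OF _ int int], auto)
  moreover have "\<bar>LINT y:{T..<real N + 1}|lborel. F y\<bar> \<le> H * ?W 1"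
  proof -
    have "\<bar>F y - 0\<bar> \<le> H * ?W 1" if "y \<in> {T..<real N + 1}" for y
      using that T H H0 star_area_antimono[OF c, of 1 y b] star_area_nonneg[of b c]
      unfolding F_def diff_zero abs_mult by (intro mult_mono) auto
    from set_integral_near_const[of T "real N + 1" F 0, OF int _ this] N
    have "\<bar>LINT y:{T..<real N + 1}|lborel. F y\<bar> \<le> H * ?W 1 * (real N + 1 - T)" by simp
    also have "\<dots> \<le> H * ?W 1 * 1" using N H0 star_area_nonneg by (intro mult_left_mono mult_nonneg_nonneg) auto
    finally show ?thesis by simp
  qed
  moreover have "real N * K + H * (?W 1 - ?W (real N + 1)) \<le> L * ?W 1 + H * ?W 1"
  proof (rule add_mono)
    have "real N * K = (real N / T) * (L * ?W 1)" by (simp add: K_def)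
    also have "\<dots> \<le> 1 * (L * ?W 1)" using N T L0 star_area_nonneg by (intro mult_right_mono) auto
    finally show "real N * K \<le> L * ?W 1" by simp
    show "H * (?W 1 - ?W (real N + 1)) \<le> H * ?W 1" using H0 star_area_nonneg by (intro mult_left_mono) auto
  qed
  ultimately show ?thesis using main[of N] by (simp add: algebra_simps)
qed

section \<open>The moment bound\<close>

lemma hit_set_iff:
  "x \<in> hit_set b c q \<longleftrightarrow> max (dist_nearest_int (real q * fst x)) (dist_nearest_int (real q * snd x)) \<le> c \<and>
     real q * dist_nearest_int (real q * fst x) * dist_nearest_int (real q * snd x) \<le> b"
  by (simp add: hit_set_def hyp_star_def abs_mult ac_simps)

lemma S_Omega_eq:
  assumes "real N < T" "T \<le> real N + 1" "a < b"
  shows "S_Omega T a b c h x =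
    (\<Sum>q=1..N. h (real q / T) * (indicator (hit_set b c q) x - indicator (hit_set a c q) x))"
proof -
  have Q: "Q_Omega T a b c x = {q\<in>{1..N}. x \<in> hit_set b c q \<and> x \<notin> hit_set a c q}"
    using assms by (cases x) (auto simp: Q_Omega_def hit_set_iff not_le)
  have sub: "hit_set a c q \<subseteq> hit_set b c q" for q
    using assms(3) by (auto simp: hit_set_iff)
  have "S_Omega T a b c h x = (\<Sum>q=1..N. if x \<in> hit_set b c q \<and> x \<notin> hit_set a c q then h (real q / T) else 0)"
    unfolding S_Omega_def Q by (rule sum.inter_filter) simp
  also have "\<dots> = (\<Sum>q=1..N. h (real q / T) * (indicator (hit_set b c q) x - indicator (hit_set a c q) x))"
    using sub by (intro sum.cong refl) (auto simp: indicator_def)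
  finally show ?thesis .
qed

lemma measure_slice_Omega:
  assumes "0 < c" "a < b"
  shows "measure lborel (slice (Omega T a b c) y)
    = indicator {1..<T} y * (star_area b c y - star_area a c y)"
proof (cases "y \<in> {1..<T}")
  case True
  then have "slice (Omega T a b c) y = hyp_star b c y - hyp_star a c y"
    by (auto simp: slice_def Omega_def hyp_star_def)
  moreover have "hyp_star a c y \<subseteq> hyp_star b c y" using assms by (auto simp: hyp_star_def)
  moreover have "emeasure lborel (hyp_star b c y) \<noteq> \<infinity>"
    using emeasure_hyp_star_finite[OF assms(1), of b y] by auto
  ultimately show ?thesis
    using True measure_Diff[of lborel "hyp_star b c y" "hyp_star a c y"] by (simp add: sets_hyp_star star_area_def)
next
  case False
  then have "slice (Omega T a b c) y = {}" by (auto simp: slice_def Omega_def)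
  then show ?thesis using False by simp
qed

text \<open>The slice at \<open>y = T\<close> is empty, so the closed interval in
  \<open>M_Omega\<close> and the half-open one give the same integrand.\<close>

lemma M_Omega_eq:
  assumes "0 < c" "a < b" "h \<in> borel_measurable borel" "\<And>s. \<bar>h s\<bar> \<le> H"
  shows "M_Omega T a b c h =
    (LINT y:{1..<T}|lborel. h (y / T) * star_area b c y) - (LINT y:{1..<T}|lborel. h (y / T) * star_area a c y)"
proof -
  have "M_Omega T a b c h = (LINT y:{1..<T}|lborel. h (y / T) * star_area b c y - h (y / T) * star_area a c y)"
    unfolding M_Omega_def set_lebesgue_integral_def measure_slice_Omega[OF assms(1,2)]
    by (intro Bochner_Integration.integral_cong refl) (auto simp: indicator_def algebra_simps)
  also have "\<dots> = (LINT y:{1..<T}|lborel. h (y / T) * star_area b c y) - (LINT y:{1..<T}|lborel. h (y / T) * star_area a c y)"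
    by (rule set_integral_diff(2)[OF set_integrable_weighted_area[OF assms(1,3,4)] set_integrable_weighted_area[OF assms(1,3,4)]])
  finally show ?thesis .
qed

text \<open>Two numbers bounded by \<open>c < 1/2\<close> have product at most 1/4, so the
  hyperbolic product never exceeds \<open>T / 4\<close>. This settles small T, where powers of
  \<open>ln (ln T)\<close> are too small to absorb a constant.\<close>

lemma Omega_empty:
  assumes "T / 4 < a" "0 < c" "c < 1/2"
  shows "Q_Omega T a b c x = {}" and "slice (Omega T a b c) y = {}"
proof -
  have small: "r * (s * t) < a" if "0 \<le> r" "r < T" "0 \<le> s" "s \<le> c" "0 \<le> t" "t \<le> c" for r s t :: real
  proof -
    have "s * t \<le> (1/2) * (1/2)" using that assms by (intro mult_mono) auto
    then have "r * (s * t) \<le> T * (1/4)" using that by (intro mult_mono) auto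
    then show ?thesis using assms by simp
  qed
  show "Q_Omega T a b c x = {}"
    using small[of "real _" "dist_nearest_int _" "dist_nearest_int _"]
    by (cases x) (fastforce simp: Q_Omega_def mult.assoc)
  show "slice (Omega T a b c) y = {}"
    using small[of y "\<bar>_\<bar>" "\<bar>_\<bar>"]
    by (fastforce simp: slice_def Omega_def abs_mult mult.commute)
qed

lemma theta_fun_le_square:
  assumes "\<kappa> > 0"
  shows "theta_fun \<kappa> s \<le> s\<^sup>2"
proof -
  have "1 = ln (exp 1 :: real)" by simp
  also have "\<dots> \<le> ln (exp 1 + \<bar>s\<bar>)" by (subst ln_le_cancel_iff) (auto simp: add_pos_nonneg)
  finally have "1 \<le> ln (exp 1 + \<bar>s\<bar>) powr (1 + \<kappa>)" using assms by (intro ge_one_powr_ge_zero) auto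
  then have "s\<^sup>2 / ln (exp 1 + \<bar>s\<bar>) powr (1 + \<kappa>) \<le> s\<^sup>2 / 1" by (intro divide_left_mono) auto
  then show ?thesis by (simp add: theta_fun_def)
qed

lemma ex_nat_below:
  assumes "T > 1"
  obtains N :: nat where "N \<ge> 1" "real N < T" "T \<le> real N + 1"
proof
  \<comment> \<open>The condition \<open>q < T\<close> is strict, so for an integral T the last
    admissible q is \<open>T - 1\<close>.\<close>
  let ?N = "nat (\<lceil>T\<rceil> - 1)"
  show "?N \<ge> 1" "real ?N < T" "T \<le> real ?N + 1" using assms by linarith+
qed

text \<open>The quantity is \<open>V b - V a + s\<close>, with \<open>s\<close> the difference of
  the two biases. Its square costs a factor 3: \<open>3264 = 3 * 2 * 544\<close> from the two
  variances, and \<open>192 = 3 * 64\<close> with \<open>64 = 2 * 2 * 16\<close> from the two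
  biases.\<close>

lemma second_moment_bound:
  fixes h :: "real \<Rightarrow> real" and T a b c \<theta> \<kappa> L H :: real
  assumes T: "T > 1" "1 \<le> ln T" and ab: "0 < a" "a < b" "b < 1" and c: "0 < c" "c < 1/2"
    and L: "L-lipschitz_on UNIV h" and H: "\<And>s. \<bar>h s\<bar> \<le> H"
    and \<theta>: "\<theta> > 0" "ln T powr - \<theta> \<le> a" and \<kappa>: "\<kappa> > 0"
  shows "(LINT x:{0..<1} \<times> {0..<1}|lborel. theta_fun \<kappa> (S_Omega T a b c h x - M_Omega T a b c h))
    \<le> (3264 * H\<^sup>2 * (4 + \<theta>) + 192 * (L + 2 * H)\<^sup>2 * (1 + \<theta>)\<^sup>2) * b * (ln T)\<^sup>2"
proof -
  let ?l = "ln T"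
  obtain N :: nat where N: "N \<ge> 1" "real N < T" "T \<le> real N + 1" using ex_nat_below[OF T(1)] .
  have hm: "h \<in> borel_measurable borel"
    using lipschitz_on_continuous_on[OF L] by (rule borel_measurable_continuous_onI)
  have lnN: "0 \<le> ln N" "ln N \<le> ?l" using N by auto
  define R where "R v = 272 * v * (1 + ln N) * (1 + 3 * ln N + ln (1 / v))" for v
  define V where "V v x = (\<Sum>q=1..N. h (real q / T) * (indicator (hit_set v c q) x - star_area v c (real q)))" for v x
  define \<beta> where "\<beta> v = (\<Sum>q=1..N. h (real q / T) * star_area v c (real q))
      - (LINT y:{1..<T}|lborel. h (y / T) * star_area v c y)" for v
  \<comment> \<open>The lower bound on a is used here, followed by
    \<open>ln (ln T) \<le> ln T\<close>.\<close>
  have lnv: "0 \<le> ln (1 / v)" "ln (1 / v) \<le> \<theta> * ?l" if "a \<le> v" "v \<le> b" for v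
  proof -
    have v: "0 < v" "v < 1" using that ab by auto
    then show "0 \<le> ln (1 / v)" by (auto intro!: ln_ge_zero simp: field_simps)
    have "exp (- \<theta> * ln ?l) \<le> v" using \<theta> that T by (simp add: powr_def)
    then have "- \<theta> * ln ?l \<le> ln v" using v by (simp add: ln_ge_iff)
    then have "ln (1 / v) \<le> \<theta> * ln ?l" using v by (simp add: ln_div)
    also have "\<dots> \<le> \<theta> * ?l"
    proof (rule mult_left_mono)
      show "ln ?l \<le> ?l" using ln_le_minus_one[of ?l] T by linarith
    qed (use \<theta> in simp)
    finally show "ln (1 / v) \<le> \<theta> * ?l" .
  qed
  have R: "R v \<le> 544 * (4 + \<theta>) * b * ?l\<^sup>2" if v: "a \<le> v" "v \<le> b" for v
  proof -
    have "R v \<le> 272 * b * (2 * ?l) * ((4 + \<theta>) * ?l)"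
      unfolding R_def using lnv[OF v] lnN T v ab by (intro mult_mono) (auto simp: algebra_simps)
    then show ?thesis by (simp add: power2_eq_square algebra_simps)
  qed
  have var: "set_integrable lborel ({0..<1} \<times> {0..<1}) (\<lambda>x. (V v x)\<^sup>2)"
     "(LINT x:{0..<1} \<times> {0..<1}|lborel. (V v x)\<^sup>2) \<le> H\<^sup>2 * (544 * (4 + \<theta>) * b * ?l\<^sup>2)" if v: "a \<le> v" "v \<le> b" for v
  proof -
    have v': "0 < v" "v \<le> 1" using v ab by auto
    note vb = variance_bound[OF v' c N(1), of "\<lambda>q. h (real q / T)" H, OF H, folded star_area_def, folded V_def R_def]
    show "set_integrable lborel ({0..<1} \<times> {0..<1}) (\<lambda>x. (V v x)\<^sup>2)" by (rule vb)
    note vb(2)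
    also have "H\<^sup>2 * R v \<le> H\<^sup>2 * (544 * (4 + \<theta>) * b * ?l\<^sup>2)" using R[OF v] by (intro mult_left_mono) auto
    finally show "(LINT x:{0..<1} \<times> {0..<1}|lborel. (V v x)\<^sup>2) \<le> H\<^sup>2 * (544 * (4 + \<theta>) * b * ?l\<^sup>2)" .
  qed
  have bias: "(\<beta> v)\<^sup>2 \<le> 16 * (L + 2 * H)\<^sup>2 * (1 + \<theta>)\<^sup>2 * b * ?l\<^sup>2" if v: "a \<le> v" "v \<le> b" for v
  proof -
    have v': "0 < v" "v \<le> 1" using v ab by auto
    have LH: "0 \<le> L + 2 * H" using lipschitz_on_nonneg[OF L] H[of 0] by linarith
    have "\<bar>\<beta> v\<bar> \<le> (L + 2 * H) * star_area v c 1"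
      unfolding \<beta>_def by (rule sum_integral_weighted_area[OF c(1) T(1) N(2,3) L H])
    also have "\<dots> \<le> (L + 2 * H) * (4 * v * ((1 + \<theta>) * ?l))"
    proof (intro mult_left_mono[OF _ LH])
      have "1 + ln (1 / v) \<le> (1 + \<theta>) * ?l" using lnv[OF v] T by (simp add: algebra_simps)
      then have "4 * v * (1 + ln (1 / v)) \<le> 4 * v * ((1 + \<theta>) * ?l)" using v' by (intro mult_left_mono) auto
      with star_area_one_le[OF v' c] show "star_area v c 1 \<le> 4 * v * ((1 + \<theta>) * ?l)" by linarith
    qed
    finally have "\<bar>\<beta> v\<bar>\<^sup>2 \<le> ((L + 2 * H) * (4 * v * ((1 + \<theta>) * ?l)))\<^sup>2" by (intro power_mono) auto
    also have "\<dots> = (16 * (L + 2 * H)\<^sup>2 * (1 + \<theta>)\<^sup>2 * ?l\<^sup>2) * v\<^sup>2" by (simp add: power_mult_distrib)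
    \<comment> \<open>The squared bias is quadratic in v up to logarithms; as
      \<open>v \<le> 1\<close>, one factor v is dropped to match a bound linear in b.\<close>
    also have "\<dots> \<le> (16 * (L + 2 * H)\<^sup>2 * (1 + \<theta>)\<^sup>2 * ?l\<^sup>2) * b"
    proof (rule mult_left_mono)
      have "v\<^sup>2 \<le> 1 * v" unfolding power2_eq_square using v' by (intro mult_right_mono) auto
      then show "v\<^sup>2 \<le> b" using v by simp
    qed simp
    finally show ?thesis by (simp add: ac_simps)
  qed
  define s where "s = \<beta> b - \<beta> a"
  have sq2: "(x - y)\<^sup>2 \<le> 2 * x\<^sup>2 + 2 * y\<^sup>2" for x y :: real
    using zero_le_power2[of "x + y"] by (simp add: power2_sum power2_diff)
  have s: "s\<^sup>2 \<le> 64 * (L + 2 * H)\<^sup>2 * (1 + \<theta>)\<^sup>2 * b * ?l\<^sup>2"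
    using sq2[of "\<beta> b" "\<beta> a"] bias[of a] bias[of b] ab by (simp add: s_def)
  have diff: "S_Omega T a b c h x - M_Omega T a b c h = V b x - V a x + s" for x
    unfolding S_Omega_eq[OF N(2,3) ab(2)] M_Omega_eq[OF c(1) ab(2) hm H] V_def s_def \<beta>_def
    by (simp add: algebra_simps sum_subtractf sum.distrib)
  have sq3: "(x - y + z)\<^sup>2 \<le> 3 * x\<^sup>2 + 3 * y\<^sup>2 + 3 * z\<^sup>2" for x y z :: real
  proof -
    \<comment> \<open>The sum of these squares is exactly the right-hand side minus the left-hand
      side.\<close>
    have "0 \<le> (x + y)\<^sup>2 + (x - z)\<^sup>2 + (y + z)\<^sup>2" by simp
    then show ?thesis by (simp add: power2_sum power2_diff algebra_simps)
  qed
  have ss: "set_integrable lborel ({0..<1} \<times> {0..<1}) (\<lambda>_ :: real \<times> real. 3 * s\<^sup>2)"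
    "(LINT x:({0..<1} \<times> {0..<1} :: (real \<times> real) set)|lborel. 3 * s\<^sup>2) = 3 * s\<^sup>2"
  proof -
    show "set_integrable lborel ({0..<1} \<times> {0..<1}) (\<lambda>_ :: real \<times> real. 3 * s\<^sup>2)"
      unfolding set_integrable_def
      by (intro integrable_scaleR_left integrable_real_indicator) (auto simp: emeasure_unit_square)
    show "(LINT x:({0..<1} \<times> {0..<1} :: (real \<times> real) set)|lborel. 3 * s\<^sup>2) = 3 * s\<^sup>2"
      by (subst set_integral_const) (auto simp: emeasure_unit_square measure_def)
  qed
  have v3: "set_integrable lborel ({0..<1} \<times> {0..<1}) (\<lambda>x. 3 * (V v x)\<^sup>2)" if "a \<le> v" "v \<le> b" for v
    using var(1)[OF that] by (intro set_integrable_mult_right)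
  let ?G = "\<lambda>x. 3 * (V b x)\<^sup>2 + 3 * (V a x)\<^sup>2 + 3 * s\<^sup>2"
  have Gint: "set_integrable lborel ({0..<1} \<times> {0..<1}) ?G"
    using ab by (intro set_integral_add v3 ss) auto
  have "(LINT x:{0..<1} \<times> {0..<1}|lborel. theta_fun \<kappa> (S_Omega T a b c h x - M_Omega T a b c h))
      \<le> (LINT x:{0..<1} \<times> {0..<1}|lborel. ?G x)"
    unfolding set_lebesgue_integral_def
  \<comment> \<open>Only the majorant has to be integrable and nonnegative; nothing about the
    integrability of the \<open>theta_fun\<close> term has to be shown.\<close>
  proof (rule integral_mono'[OF Gint[unfolded set_integrable_def]])
    fix x
    have "theta_fun \<kappa> (S_Omega T a b c h x - M_Omega T a b c h) \<le> ?G x"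
      unfolding diff using theta_fun_le_square[OF \<kappa>] sq3 order_trans by blast
    then show "indicator ({0..<1} \<times> {0..<1}) x *\<^sub>R theta_fun \<kappa> (S_Omega T a b c h x - M_Omega T a b c h)
      \<le> indicator ({0..<1} \<times> {0..<1}) x *\<^sub>R ?G x" by (simp add: indicator_def)
  qed (simp add: indicator_def)
  also have "\<dots> = 3 * (LINT x:{0..<1} \<times> {0..<1}|lborel. (V b x)\<^sup>2) + 3 * (LINT x:{0..<1} \<times> {0..<1}|lborel. (V a x)\<^sup>2) + 3 * s\<^sup>2"
  proof -
    have "(LINT x:{0..<1} \<times> {0..<1}|lborel. ?G x) = (LINT x:{0..<1} \<times> {0..<1}|lborel. 3 * (V b x)\<^sup>2 + 3 * (V a x)\<^sup>2)
       + (LINT x:({0..<1} \<times> {0..<1} :: (real \<times> real) set)|lborel. 3 * s\<^sup>2)"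
      using ab by (intro set_integral_add(2) set_integral_add(1) v3 ss) auto
    also have "(LINT x:{0..<1} \<times> {0..<1}|lborel. 3 * (V b x)\<^sup>2 + 3 * (V a x)\<^sup>2)
       = (LINT x:{0..<1} \<times> {0..<1}|lborel. 3 * (V b x)\<^sup>2) + (LINT x:{0..<1} \<times> {0..<1}|lborel. 3 * (V a x)\<^sup>2)"
      using ab by (intro set_integral_add(2) v3) auto
    finally show ?thesis unfolding ss by simp
  qed
  also have "\<dots> \<le> (3264 * H\<^sup>2 * (4 + \<theta>) + 192 * (L + 2 * H)\<^sup>2 * (1 + \<theta>)\<^sup>2) * b * ?l\<^sup>2"
    using var(2)[of a] var(2)[of b] s ab by (simp add: algebra_simps)
  finally show ?thesis .
qed

text \<open>In terms of \<open>e = ln (ln T)\<close> the last inequality says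
  \<open>f e > 0\<close>. At \<open>e = 0\<close> the value is \<open>1 - exp 1 / 4\<close>, which
  is positive, so continuity gives a neighbourhood. Positivity of \<open>ln (ln T)\<close> holds
  because a negative power below 1 forces \<open>ln T > 1\<close>.\<close>

lemma ln_ln_lower_bound:
  assumes "\<theta> > 0"
  obtains \<epsilon> :: real where "\<epsilon> > 0"
    "\<And>T. T > 1 \<Longrightarrow> ln T powr - \<theta> < 1 \<Longrightarrow> 0 < ln (ln T)"
    "\<And>T. T > 1 \<Longrightarrow> ln T powr - \<theta> < 1 \<Longrightarrow> ln (ln T) < \<epsilon> \<Longrightarrow> T / 4 < ln T powr - \<theta>"
proof -
  define f :: "real \<Rightarrow> real" where "f e = exp (- \<theta> * e) - exp (exp e) / 4" for e
  have "isCont f 0" unfolding f_def by (intro continuous_intros) auto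
  then have "(f \<longlongrightarrow> f 0) (at 0)" by (simp add: isCont_def)
  moreover have "0 < f 0" using exp_le by (simp add: f_def)
  ultimately have "\<forall>\<^sub>F e in at 0. 0 < f e" by (rule order_tendstoD(1))
  then obtain \<epsilon> where \<epsilon>: "\<epsilon> > 0" "\<And>e. e \<noteq> 0 \<Longrightarrow> dist e 0 < \<epsilon> \<Longrightarrow> 0 < f e"
    unfolding eventually_at by auto
  have pos: "0 < ln (ln T)" if "T > 1" "ln T powr - \<theta> < 1" for T
  proof (rule ccontr)
    assume "\<not> 0 < ln (ln T)"
    then have "0 \<le> - \<theta> * ln (ln T)" using assms by (simp add: mult_nonneg_nonpos)
    then have "1 \<le> exp (- \<theta> * ln (ln T))" by simp
    then show False using that by (simp add: powr_def)
  qed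
  have "T / 4 < ln T powr - \<theta>" if "T > 1" "ln T powr - \<theta> < 1" "ln (ln T) < \<epsilon>" for T
  proof -
    have "0 < f (ln (ln T))" using \<epsilon>(2)[of "ln (ln T)"] pos[OF that(1,2)] that(3) by (simp add: dist_real_def)
    then show ?thesis using that(1) by (simp add: f_def powr_def)
  qed
  with pos \<epsilon>(1) show ?thesis using that by blast
qed

text \<open>Stated for bounded Lipschitz weights, so that both a compactly supported h and the
  constant 1 are covered.\<close>

lemma theta_moment_bound:
  fixes h :: "real \<Rightarrow> real" and \<theta> \<kappa> :: real
  assumes \<theta>: "\<theta> > 0" and L: "L-lipschitz_on UNIV h" and H: "\<And>s. \<bar>h s\<bar> \<le> H" and \<kappa>: "\<kappa> > 0"
  shows "\<exists>C>0. \<forall>T a b c :: real.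
     T > 1 \<and> a > 0 \<and> b > 0 \<and> c > 0 \<and> a < b \<and> b < 1 \<and> c < 1 / 2 \<and> a \<ge> ln T powr (- \<theta>) \<longrightarrow>
     (LINT x:{0..<1} \<times> {0..<1}|lborel. theta_fun \<kappa> (S_Omega T a b c h x - M_Omega T a b c h))
       \<le> C * c powi (-2) * b * ln (ln T) powr (3 + \<kappa>) * (ln T)\<^sup>2"
proof -
  obtain \<epsilon> :: real where \<epsilon>: "\<epsilon> > 0"
    "\<And>T. T > 1 \<Longrightarrow> ln T powr - \<theta> < 1 \<Longrightarrow> 0 < ln (ln T)"
    "\<And>T. T > 1 \<Longrightarrow> ln T powr - \<theta> < 1 \<Longrightarrow> ln (ln T) < \<epsilon> \<Longrightarrow> T / 4 < ln T powr - \<theta>"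
    using ln_ln_lower_bound[OF \<theta>] by blast
  define K where "K = 3264 * H\<^sup>2 * (4 + \<theta>) + 192 * (L + 2 * H)\<^sup>2 * (1 + \<theta>)\<^sup>2"
  have K: "0 \<le> K" using \<theta> by (simp add: K_def)
  \<comment> \<open>Off the empty case the log-log factor is at least
    \<open>\<epsilon> powr (3 + \<kappa>)\<close>, so dividing by this power pays for it. The added
    1 keeps the constant positive when \<open>K = 0\<close>.\<close>
  define C where "C = K / \<epsilon> powr (3 + \<kappa>) + 1"
  have C: "C > 0" using K \<epsilon>(1) by (simp add: C_def add_nonneg_pos)
  show ?thesis
  proof (intro exI[of _ C] conjI C allI impI)
    fix T a b c :: real
    assume "T > 1 \<and> a > 0 \<and> b > 0 \<and> c > 0 \<and> a < b \<and> b < 1 \<and> c < 1 / 2 \<and> a \<ge> ln T powr (- \<theta>)"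
    then have T: "T > 1" and ab: "0 < a" "a < b" "b < 1" and c: "0 < c" "c < 1/2" and a: "ln T powr - \<theta> \<le> a" by auto
    have lt1: "ln T powr - \<theta> < 1" using a ab by simp
    note lnln = \<epsilon>(2)[OF T lt1]
    let ?I = "LINT x:{0..<1} \<times> {0..<1}|lborel. theta_fun \<kappa> (S_Omega T a b c h x - M_Omega T a b c h)"
    show "?I \<le> C * c powi (-2) * b * ln (ln T) powr (3 + \<kappa>) * (ln T)\<^sup>2"
    proof (cases "ln (ln T) < \<epsilon>")
      case True
      then have "T / 4 < a" using \<epsilon>(3)[OF T lt1] a by simp
      then have "?I = 0"
        by (simp add: S_Omega_def M_Omega_def Omega_empty[OF _ c] theta_fun_def)
      also have "0 \<le> C * c powi (-2) * b * ln (ln T) powr (3 + \<kappa>) * (ln T)\<^sup>2"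
        using C ab c by (intro mult_nonneg_nonneg) auto
      finally show ?thesis .
    next
      case False
      have l1: "1 \<le> ln T" using lnln T by (metis less_imp_le ln_gt_zero ln_gt_zero_imp_gt_one)
      have p: "\<epsilon> powr (3 + \<kappa>) \<le> ln (ln T) powr (3 + \<kappa>)"
        using False \<epsilon>(1) \<kappa> by (intro powr_mono2) auto
      have "K = K / \<epsilon> powr (3 + \<kappa>) * \<epsilon> powr (3 + \<kappa>)" using \<epsilon>(1) by simp
      also have "\<dots> \<le> C * ln (ln T) powr (3 + \<kappa>)"
        using p K C by (intro mult_mono) (auto simp: C_def)
      also have "\<dots> \<le> c powi (-2) * (C * ln (ln T) powr (3 + \<kappa>))"
      proof -
        have "c\<^sup>2 \<le> 1" using c by (simp add: power_le_one)
        then have "1 \<le> c powi (-2)" using c by (simp add: power_int_minus one_le_inverse_iff)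
        then have "1 * (C * ln (ln T) powr (3 + \<kappa>)) \<le> c powi (-2) * (C * ln (ln T) powr (3 + \<kappa>))"
          using C by (intro mult_right_mono) auto
        then show ?thesis by simp
      qed
      finally have KC: "K \<le> c powi (-2) * (C * ln (ln T) powr (3 + \<kappa>))" .
      have "?I \<le> K * (b * (ln T)\<^sup>2)"
        using second_moment_bound[OF T l1 ab c L H \<theta> a \<kappa>] by (simp add: K_def mult.assoc)
      also have "\<dots> \<le> (c powi (-2) * (C * ln (ln T) powr (3 + \<kappa>))) * (b * (ln T)\<^sup>2)"
        using KC ab by (intro mult_right_mono) auto
      finally show ?thesis by (simp only: ac_simps)
    qed
  qed
qed

section \<open>The volume of \<open>Omega\<close> as the main term for the constant weight\<close>

lemma sets_Omega: "Omega T a b c \<in> sets borel"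
proof -
  have "Omega T a b c = {p. 1 \<le> snd p \<and> snd p < T \<and> max \<bar>fst (fst p)\<bar> \<bar>snd (fst p)\<bar> \<le> c \<and>
     a < \<bar>fst (fst p) * snd (fst p)\<bar> * snd p \<and> \<bar>fst (fst p) * snd (fst p)\<bar> * snd p \<le> b}"
    by (auto simp: Omega_def)
  also have "\<dots> \<in> sets borel"
  proof -
    let ?M = "(borel \<Otimes>\<^sub>M borel) \<Otimes>\<^sub>M borel :: ((real \<times> real) \<times> real) measure"
    have "{p \<in> space ?M. 1 \<le> snd p \<and> snd p < T \<and> max \<bar>fst (fst p)\<bar> \<bar>snd (fst p)\<bar> \<le> c \<and>
       a < \<bar>fst (fst p) * snd (fst p)\<bar> * snd p \<and> \<bar>fst (fst p) * snd (fst p)\<bar> * snd p \<le> b} \<in> sets ?M"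
      by measurable
    then show ?thesis unfolding borel_prod by simp
  qed
  finally show ?thesis .
qed

lemma measure_Omega_eq_M_Omega:
  assumes "0 < c" "a < b"
  shows "measure lborel (Omega T a b c) = M_Omega T a b c (\<lambda>_. 1)"
proof -
  have O: "Omega T a b c \<in> sets (lborel \<Otimes>\<^sub>M lborel)"
    unfolding lborel_prod sets_lborel by (rule sets_Omega)
  have fin: "emeasure lborel (slice (Omega T a b c) y) = ennreal (measure lborel (slice (Omega T a b c) y))" for y
  proof -
    have "emeasure lborel (slice (Omega T a b c) y) \<le> emeasure lborel (cbox (-c, -c) (c, c))"
      by (intro emeasure_mono) (auto simp: slice_def Omega_def cbox_Pair_eq abs_le_iff)
    also have "\<dots> < \<infinity>" by (rule emeasure_lborel_cbox_finite)
    finally show ?thesis by (intro emeasure_eq_ennreal_measure) auto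
  qed
  have "emeasure lborel (Omega T a b c) = (\<integral>\<^sup>+y. emeasure lborel ((\<lambda>u. (u, y)) -` Omega T a b c) \<partial>lborel)"
    using lborel_pair.emeasure_pair_measure_alt2[OF O] by (simp only: lborel_prod)
  also have "\<dots> = (\<integral>\<^sup>+y. ennreal (measure lborel (slice (Omega T a b c) y)) \<partial>lborel)"
    unfolding fin[symmetric] by (simp add: slice_def vimage_def)
  finally have "measure lborel (Omega T a b c) = enn2real (\<integral>\<^sup>+y. ennreal (measure lborel (slice (Omega T a b c) y)) \<partial>lborel)"
    by (simp add: measure_def)
  also have "\<dots> = (\<integral>y. measure lborel (slice (Omega T a b c) y) \<partial>lborel)"
  proof (rule integral_eq_nn_integral[symmetric])
    show "(\<lambda>y. measure lborel (slice (Omega T a b c) y)) \<in> borel_measurable lborel"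
      unfolding measure_slice_Omega[OF assms]
      using borel_measurable_star_area[OF assms(1)] by measurable
  qed simp
  also have "\<dots> = M_Omega T a b c (\<lambda>_. 1)"
    unfolding M_Omega_def set_lebesgue_integral_def
    by (intro Bochner_Integration.integral_cong refl) (auto simp: measure_slice_Omega[OF assms] indicator_def)
  finally show ?thesis .
qed

lemma bounded_if_compactly_supported:
  assumes "compactly_supported h" "L-lipschitz_on UNIV h"
  obtains H where "\<And>s. \<bar>h s\<bar> \<le> H"
proof -
  let ?K = "closure {x. h x \<noteq> 0}"
  have "continuous_on ?K h" using lipschitz_on_continuous_on[OF assms(2)] by (rule continuous_on_subset) simp
  then have "bounded (h ` ?K)"
    using assms(1) by (intro compact_imp_bounded compact_continuous_image) (auto simp: compactly_supported_def)
  then obtain H where H: "\<And>s. s \<in> ?K \<Longrightarrow> \<bar>h s\<bar> \<le> H" by (auto simp: bounded_iff)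
  have "\<bar>h s\<bar> \<le> max H 0" for s
  proof (cases "h s = 0")
    case False
    then have "s \<in> ?K" using closure_subset[of "{x. h x \<noteq> 0}"] by auto
    then show ?thesis using H[of s] by simp
  qed simp
  then show thesis by (rule that)
qed

theorem theorem1p3:
  fixes \<zeta> \<theta> :: real
  assumes "\<zeta> > 0" and "\<theta> > 0"
  shows
    "(\<forall>(h :: real \<Rightarrow> real) (\<kappa> :: real).
        compactly_supported h \<and> (\<exists>L. L-lipschitz_on UNIV h) \<and> \<kappa> > 0 \<longrightarrow>
        (\<exists>C > 0. \<forall>T a b c :: real.
           T > 1 \<and> a > 0 \<and> b > 0 \<and> c > 0 \<and> a < b \<and> b < 1 \<and> c < 1 / 2 \<and>
           a \<ge> ln T powr (- \<theta>) \<and> \<zeta> * b \<le> c\<^sup>2 \<longrightarrow>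
           (LINT x:{0..<1} \<times> {0..<1}|lborel.
              theta_fun \<kappa> (S_Omega T a b c h x - M_Omega T a b c h))
             \<le> C * c powi (-2) * b * ln (ln T) powr (3 + \<kappa>) * (ln T)\<^sup>2))
     \<and>
     (\<forall>\<kappa> > 0. \<exists>C' > 0. \<forall>T a b c :: real.
           T > 1 \<and> a > 0 \<and> b > 0 \<and> c > 0 \<and> a < b \<and> b < 1 \<and> c < 1 / 2 \<and>
           a \<ge> ln T powr (- \<theta>) \<and> \<zeta> * b \<le> c\<^sup>2 \<longrightarrow>
           (LINT x:{0..<1} \<times> {0..<1}|lborel.
              theta_fun \<kappa> (real (card (Q_Omega T a b c x)) - measure lborel (Omega T a b c)))
             \<le> C' * c powi (-2) * b * ln (ln T) powr (3 + \<kappa>) * (ln T)\<^sup>2)"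
proof (intro conjI allI impI)
  fix h :: "real \<Rightarrow> real" and \<kappa> :: real
  assume "compactly_supported h \<and> (\<exists>L. L-lipschitz_on UNIV h) \<and> \<kappa> > 0"
  then obtain L where h: "compactly_supported h" "L-lipschitz_on UNIV h" "\<kappa> > 0" by auto
  obtain H where H: "\<And>s. \<bar>h s\<bar> \<le> H" using bounded_if_compactly_supported[OF h(1,2)] by auto
  show "\<exists>C > 0. \<forall>T a b c :: real.
           T > 1 \<and> a > 0 \<and> b > 0 \<and> c > 0 \<and> a < b \<and> b < 1 \<and> c < 1 / 2 \<and>
           a \<ge> ln T powr (- \<theta>) \<and> \<zeta> * b \<le> c\<^sup>2 \<longrightarrow>
           (LINT x:{0..<1} \<times> {0..<1}|lborel.
              theta_fun \<kappa> (S_Omega T a b c h x - M_Omega T a b c h))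
             \<le> C * c powi (-2) * b * ln (ln T) powr (3 + \<kappa>) * (ln T)\<^sup>2"
    using theta_moment_bound[OF assms(2) h(2) H h(3)] by blast
next
  fix \<kappa> :: real
  assume \<kappa>: "\<kappa> > 0"
  \<comment> \<open>The count is the sum with weight 1. This weight is not compactly supported, but
    it is bounded and Lipschitz, as \<open>theta_moment_bound\<close> requires.\<close>
  have one: "1-lipschitz_on UNIV (\<lambda>_ :: real. 1 :: real)" by (intro lipschitz_onI) auto
  have card: "real (card (Q_Omega T a b c x)) = S_Omega T a b c (\<lambda>_. 1) x" for T a b c x
    by (simp add: S_Omega_def)
  obtain C where C: "C > 0" "\<And>T a b c :: real.
     T > 1 \<and> a > 0 \<and> b > 0 \<and> c > 0 \<and> a < b \<and> b < 1 \<and> c < 1 / 2 \<and> a \<ge> ln T powr (- \<theta>) \<Longrightarrow>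
     (LINT x:{0..<1} \<times> {0..<1}|lborel. theta_fun \<kappa> (S_Omega T a b c (\<lambda>_. 1) x - M_Omega T a b c (\<lambda>_. 1)))
       \<le> C * c powi (-2) * b * ln (ln T) powr (3 + \<kappa>) * (ln T)\<^sup>2"
    using theta_moment_bound[OF assms(2) one _ \<kappa>, of 1] by auto
  show "\<exists>C' > 0. \<forall>T a b c :: real.
           T > 1 \<and> a > 0 \<and> b > 0 \<and> c > 0 \<and> a < b \<and> b < 1 \<and> c < 1 / 2 \<and>
           a \<ge> ln T powr (- \<theta>) \<and> \<zeta> * b \<le> c\<^sup>2 \<longrightarrow>
           (LINT x:{0..<1} \<times> {0..<1}|lborel.
              theta_fun \<kappa> (real (card (Q_Omega T a b c x)) - measure lborel (Omega T a b c)))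
             \<le> C' * c powi (-2) * b * ln (ln T) powr (3 + \<kappa>) * (ln T)\<^sup>2"
  proof (intro exI[of _ C] conjI C(1) allI impI)
    fix T a b c :: real
    assume *: "T > 1 \<and> a > 0 \<and> b > 0 \<and> c > 0 \<and> a < b \<and> b < 1 \<and> c < 1 / 2 \<and>
           a \<ge> ln T powr (- \<theta>) \<and> \<zeta> * b \<le> c\<^sup>2"
    then have "measure lborel (Omega T a b c) = M_Omega T a b c (\<lambda>_. 1)"
      by (intro measure_Omega_eq_M_Omega) auto
    then show "(LINT x:{0..<1} \<times> {0..<1}|lborel.
              theta_fun \<kappa> (real (card (Q_Omega T a b c x)) - measure lborel (Omega T a b c)))
             \<le> C * c powi (-2) * b * ln (ln T) powr (3 + \<kappa>) * (ln T)\<^sup>2"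
      unfolding card using C(2)[of T a b c] * by simp
  qed
qed

end
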